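(* Let $(J_n,X_n)_{n\ge 0}$ be a Markov renewal process with finite state space $\mathbb{X}=\{0,\dots,m\}$ and transition probabilities $Q_{ij}(t)$, and let $J(t)$ be the associated semi-Markov process. Let $d\ge 1$ be an integer, and assume that conditions $\mathbf{A}$, $\mathbf{B}$ and $\mathbf{C}_d$ (stated in the context) hold for $J(t)$. Let $k\in\mathbb{X}$, $k\ne 0$, and let ${}_kJ(t)$ be the reduced semi-Markov process with the state $k$ excluded, with reduced phase space ${}_k\mathbb{X}=\mathbb{X}\setminus\{k\}$. Then: 1. Conditions $\mathbf{A}$, $\mathbf{B}$ and $\mathbf{C}_d$ also hold for the reduced semi-Markov process ${}_kJ(t)$. That is, ${}_k\mathbb{X}$ is a communicative class of states for the chain with transition probabilities ${}_kp_{ij}$, $i,j\in{}_k\mathbb{X}$; ${}_kQ_{ij}(0)=0$ for all $i,j\in{}_k\mathbb{X}$; and ${}_ke^{(d)}_{ij}<\infty$ for all $i,j\in{}_k\mathbb{X}$. 2. The first hitting times $W_0$ and ${}_kW_0$ to the state $0$, for the semi-Markov processes $J(t)$ and ${}_kJ(t)$ respectively, coincide (almost surely). Thus, for every $r=1,\dots,d$ and every $i\in\mathbb{X}$ (including $i=k$), $$E^{(r)}_{i0}=\mathsf{E}_i W_0^r={}_kE^{(r)}_{i0}=\mathsf{E}_i\,({}_kW_0)^r .$$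
   Context: **Markov renewal process.** $(J_n,X_n)$, $n=0,1,\dots$, is a homogeneous Markov chain with phase space $\mathbb{X}\times[0,\infty)$, $\mathbb{X}=\{0,\dots,m\}$, initial distribution $p_i=\mathsf{P}\{J_0=i,X_0=0\}=\mathsf{P}\{J_0=i\}$, $i\in\mathbb{X}$ (so $X_0=0$), and transition probabilities, not depending on $s$, $$Q_{ij}(t)=\mathsf{P}\{J_1=j,\,X_1\le t\mid J_0=i,\,X_0=s\},\qquad (i,s),(j,t)\in\mathbb{X}\times[0,\infty).$$ The sequence $J_n$ is then a homogeneous Markov chain (the embedded chain) with transition probabilities $p_{ij}=Q_{ij}(\infty)$. Let $T_n=X_1+\dots+X_n$, $T_0=0$, $N(t)=\max\{n\ge 0: T_n\le t\}$. The semi-Markov process is $J(t)=J_{N(t)}$, $t\ge 0$. $\mathsf{P}_i$ and $\mathsf{E}_i$ denote probability and expectation under the condition $J(0)=J_0=i$. **Moments.** $e^{(r)}_{ij}=\mathsf{E}_i[X_1^r I(J_1=j)]=\int_0^\infty t^r\,Q_{ij}(dt)$, $r=0,1,\dots$, with $e^{(0)}_{ij}=p_{ij}$. **Conditions.** - $\mathbf{A}$: $\mathbb{X}$ is a communicative class of states for the embedded Markov chain $J_n$ (every state can be reached from every state with positive probability). - $\mathbf{B}$: $Q_{ij}(0)=0$ for all $i,j\in\mathbb{X}$. - $\mathbf{C}_d$: $e^{(d)}_{ij}<\infty$ for all $i,j\in\mathbb{X}$. **Hitting time.** $U_0=\min\{n\ge 1: J_n=0\}$ and $W_0=\inf\{t\ge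 X_1: J(t)=0\}=\sum_{n=1}^{U_0}X_n$. For $i\in\mathbb{X}$, $E^{(r)}_{i0}=\mathsf{E}_iW_0^r$. **Reduced process.** For $k\in\mathbb{X}$ let ${}_k\mathbb{X}=\mathbb{X}\setminus\{k\}$, ${}_kV_0=0$, ${}_kV_n=\min\{r>{}_kV_{n-1}: J_r\in{}_k\mathbb{X}\}$ for $n\ge 1$, and $$({}_kJ_0,{}_kX_0)=(J_0,0),\qquad ({}_kJ_n,{}_kX_n)=\Big(J_{{}_kV_n},\ \sum_{r={}_kV_{n-1}+1}^{{}_kV_n}X_r\Big),\quad n\ge 1.$$ This is a Markov renewal process with transition probabilities ${}_kQ_{ij}(t)=\mathsf{P}_i\{{}_kJ_1=j,\,{}_kX_1\le t\}$, concentrated on $j\in{}_k\mathbb{X}$. Put ${}_kp_{ij}={}_kQ_{ij}(\infty)$ and ${}_ke^{(r)}_{ij}=\mathsf{E}_i[({}_kX_1)^rI({}_kJ_1=j)]=\int_0^\infty t^r\,{}_kQ_{ij}(dt)$. With ${}_kT_n={}_kX_1+\dots+{}_kX_n$ and ${}_kN(t)=\max\{n\ge0:{}_kT_n\le t\}$, the reduced semi-Markov process is ${}_kJ(t)={}_kJ_{{}_kN(t)}$, $t\ge 0$; its reduced phase space is ${}_k\mathbb{X}$ (if $J_0=k$, it starts at $k$ and stays in ${}_k\mathbb{X}$ after its first jump). **Hitting time of the reduced process** ($k\ne0$). ${}_kU_0=\min\{n\ge1:{}_kJ_n=0\}$, ${}_kW_0=\inf\{t\ge{}_kX_1:{}_kJ(t)=0\}=\sum_{n=1}^{{}_kU_0}{}_kX_n$,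 and ${}_kE^{(r)}_{i0}=\mathsf{E}_i({}_kW_0)^r$, $i\in\mathbb{X}$. *)

theory Defs
  imports "HOL-Probability.Probability"
begin

text \<open>The sigma-algebra generated by \<open>(J 0, X 0), \<dots>, (J n, X n)\<close>.\<close>

definition history ::
  "'w measure \<Rightarrow> nat \<Rightarrow> (nat \<Rightarrow> 'w \<Rightarrow> nat) \<Rightarrow> (nat \<Rightarrow> 'w \<Rightarrow> real) \<Rightarrow> nat \<Rightarrow> 'w measure" where
  "history M m J X n =
     vimage_algebra (space M) (\<lambda>\<omega>. \<lambda>r\<in>{..n}. (J r \<omega>, X r \<omega>))
       (\<Pi>\<^sub>M r\<in>{..n}. count_space {0..m} \<Otimes>\<^sub>M (borel :: real measure))"

text \<open>A homogeneous Markov chain \<open>(J n, X n)\<close> on \<open>{0..m} \<times> [0, \<infinity>)\<close>, started in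
  \<open>(i, 0)\<close> with probability \<open>p i\<close>. The transition probability out of \<open>(i, s)\<close> is
  \<open>Q i j t\<close>, the same for all \<open>s\<close>; since the sets \<open>{j} \<times> [0, t]\<close> are a generator closed under
  nonempty intersection, the last assumption is the full Markov property.\<close>

locale markov_renewal_process = prob_space M
  for M :: "'w measure" +
  fixes m :: nat
    and p :: "nat \<Rightarrow> real"
    and Q :: "nat \<Rightarrow> nat \<Rightarrow> real \<Rightarrow> real"
    and J :: "nat \<Rightarrow> 'w \<Rightarrow> nat"
    and X :: "nat \<Rightarrow> 'w \<Rightarrow> real"
  assumes J_measurable: "\<And>n. J n \<in> M \<rightarrow>\<^sub>M count_space {0..m}"
    and X_measurable: "\<And>n. X n \<in> M \<rightarrow>\<^sub>M restrict_space borel {0..}"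
    and initial_state: "\<And>i. i \<in> {0..m} \<Longrightarrow> measure M {\<omega> \<in> space M. J 0 \<omega> = i} = p i"
    and initial_pair:
      "\<And>i. i \<in> {0..m} \<Longrightarrow> measure M {\<omega> \<in> space M. J 0 \<omega> = i \<and> X 0 \<omega> = 0} = p i"
    and markov: "\<And>n j t. j \<in> {0..m} \<Longrightarrow> 0 \<le> t \<Longrightarrow>
      AE \<omega> in M. real_cond_exp M (history M m J X n)
          (indicator {\<omega> \<in> space M. J (Suc n) \<omega> = j \<and> X (Suc n) \<omega> \<le> t}) \<omega> = Q (J n \<omega>) j t"

definition embedded :: "(nat \<Rightarrow> nat \<Rightarrow> real \<Rightarrow> real) \<Rightarrow> nat \<Rightarrow> nat \<Rightarrow> real" where
  "embedded Q i j = Lim at_top (Q i j)"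

primrec step_prob :: "nat set \<Rightarrow> (nat \<Rightarrow> nat \<Rightarrow> real) \<Rightarrow> nat \<Rightarrow> nat \<Rightarrow> nat \<Rightarrow> real" where
  "step_prob S q 0 i j = (if i = j then 1 else 0)"
| "step_prob S q (Suc n) i j = (\<Sum>l\<in>S. q i l * step_prob S q n l j)"

text \<open>Only \<open>n \<ge> 1\<close> counts. This matters when \<open>S\<close> is a singleton: its state must then be
  reachable from itself.\<close>

definition communicative :: "nat set \<Rightarrow> (nat \<Rightarrow> nat \<Rightarrow> real) \<Rightarrow> bool" where
  "communicative S q \<longleftrightarrow> (\<forall>i\<in>S. \<forall>j\<in>S. \<exists>n\<ge>1. step_prob S q n i j > 0)"

text \<open>The expectation \<open>E[X\<^sub>1\<^sup>r I(J\<^sub>1 = j)]\<close> under \<open>M\<close>.\<close>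

definition jump_moment ::
  "'w measure \<Rightarrow> (nat \<Rightarrow> 'w \<Rightarrow> nat) \<Rightarrow> (nat \<Rightarrow> 'w \<Rightarrow> real) \<Rightarrow> nat \<Rightarrow> nat \<Rightarrow> ennreal" where
  "jump_moment M J X r j = (\<integral>\<^sup>+ \<omega>. ennreal (X 1 \<omega> ^ r) * indicator {\<omega>. J 1 \<omega> = j} \<omega> \<partial>M)"

definition renewal_time :: "(nat \<Rightarrow> 'w \<Rightarrow> real) \<Rightarrow> nat \<Rightarrow> 'w \<Rightarrow> real" where
  "renewal_time X n \<omega> = (\<Sum>r=1..n. X r \<omega>)"

text \<open>The value is meaningful only where finitely many renewal times are at most \<open>t\<close>. On the null
  set where this fails, \<open>Max\<close> returns an unspecified number.\<close>

definition renewal_count :: "(nat \<Rightarrow> 'w \<Rightarrow> real) \<Rightarrow> real \<Rightarrow> 'w \<Rightarrow> nat" where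
  "renewal_count X t \<omega> = Max {n. renewal_time X n \<omega> \<le> t}"

definition semi_markov ::
  "(nat \<Rightarrow> 'w \<Rightarrow> nat) \<Rightarrow> (nat \<Rightarrow> 'w \<Rightarrow> real) \<Rightarrow> real \<Rightarrow> 'w \<Rightarrow> nat" where
  "semi_markov J X t \<omega> = J (renewal_count X t \<omega>) \<omega>"

text \<open>Equal to \<open>\<infinity>\<close> if state \<open>0\<close> is never hit.\<close>

definition hitting_time ::
  "(nat \<Rightarrow> 'w \<Rightarrow> nat) \<Rightarrow> (nat \<Rightarrow> 'w \<Rightarrow> real) \<Rightarrow> 'w \<Rightarrow> ennreal" where
  "hitting_time J X \<omega> = (INF t\<in>{t. X 1 \<omega> \<le> t \<and> semi_markov J X t \<omega> = 0}. ennreal t)"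

definition hitting_moment ::
  "'w measure \<Rightarrow> (nat \<Rightarrow> 'w \<Rightarrow> nat) \<Rightarrow> (nat \<Rightarrow> 'w \<Rightarrow> real) \<Rightarrow> nat \<Rightarrow> ennreal" where
  "hitting_moment M J X r = (\<integral>\<^sup>+ \<omega>. hitting_time J X \<omega> ^ r \<partial>M)"

text \<open>Successive epochs at which the embedded chain is in \<open>S\<close>. If \<open>S\<close> is not visited again, the
  \<open>LEAST\<close> is unspecified.\<close>

primrec visit_epoch :: "nat set \<Rightarrow> (nat \<Rightarrow> 'w \<Rightarrow> nat) \<Rightarrow> nat \<Rightarrow> 'w \<Rightarrow> nat" where
  "visit_epoch S J 0 \<omega> = 0"
| "visit_epoch S J (Suc n) \<omega> = (LEAST r. r > visit_epoch S J n \<omega> \<and> J r \<omega> \<in> S)"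

definition reduced_J :: "nat set \<Rightarrow> (nat \<Rightarrow> 'w \<Rightarrow> nat) \<Rightarrow> nat \<Rightarrow> 'w \<Rightarrow> nat" where
  "reduced_J S J n \<omega> = J (visit_epoch S J n \<omega>) \<omega>"

definition reduced_X ::
  "nat set \<Rightarrow> (nat \<Rightarrow> 'w \<Rightarrow> nat) \<Rightarrow> (nat \<Rightarrow> 'w \<Rightarrow> real) \<Rightarrow> nat \<Rightarrow> 'w \<Rightarrow> real" where
  "reduced_X S J X n \<omega> =
     (if n = 0 then 0
      else (\<Sum>r = visit_epoch S J (n - 1) \<omega> + 1..visit_epoch S J n \<omega>. X r \<omega>))"

text \<open>Here \<open>P i\<close> is the law of the process started in state \<open>i\<close>.\<close>

definition reduced_Q ::
  "nat set \<Rightarrow> (nat \<Rightarrow> 'w measure) \<Rightarrow> (nat \<Rightarrow> 'w \<Rightarrow> nat) \<Rightarrow> (nat \<Rightarrow> 'w \<Rightarrow> real) \<Rightarrow>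
     nat \<Rightarrow> nat \<Rightarrow> real \<Rightarrow> real" where
  "reduced_Q S P J X i j t =
     measure (P i) {\<omega> \<in> space (P i). reduced_J S J 1 \<omega> = j \<and> reduced_X S J X 1 \<omega> \<le> t}"

end

theory Submission
  imports Defs
begin

text \<open>
  The Markov property in the form
  \<open>E[h g(J\<^sub>n\<^sub>+\<^sub>1, X\<^sub>n\<^sub>+\<^sub>1)] = E[h (K g)(J\<^sub>n)]\<close>, with \<open>h\<close> depending on the history up to \<open>n\<close>
  and \<open>(K g)(i) = E\<^sub>i[g(J\<^sub>1, X\<^sub>1)]\<close>, bounds the probability of staying for \<open>l\<close> steps in a set of
  states and jump lengths by \<open>c ^ l\<close>. With \<open>c < 1\<close> this shows that almost surely jumps longer than
  some \<open>\<epsilon> > 0\<close> occur infinitely often, so the renewal times are unbounded, and that the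
  chain leaves \<open>k\<close> infinitely often, so the reduced process is well defined. On this event both
  hitting times are the infimum of the renewal times at the epochs \<open>n \<ge> 1\<close> with \<open>J\<^sub>n = 0\<close>, and deleting
  the visits to \<open>k \<noteq> 0\<close> does not change the set of these times. The first jump of the reduced
  process is a sum of \<open>n\<close> jumps only if \<open>J\<^sub>1 = \<dots> = J\<^sub>n\<^sub>-\<^sub>1 = k\<close>, so its \<open>d\<close>-th moment is at most
  \<open>\<Sum>n. n ^ (d + 1) C c ^ (n - 3)\<close>.
\<close>

section \<open>The Markov property for functions of the next jump\<close>

text \<open>Half-lines are stable under intersection and generate the Borel sets, and the sets
  \<open>{..real n}\<close> exhaust the line with finite measure. The total mass is left free, so
  that the lemma applies to the law of a jump restricted to an event.\<close>

lemma measure_eqI_atMost: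
  fixes M N :: "real measure"
  assumes "sets M = sets borel" "sets N = sets borel"
    and "\<And>t. emeasure M {..t} = emeasure N {..t}"
    and "\<And>t. emeasure M {..t} \<noteq> \<infinity>"
  shows "M = N"
proof (rule measure_eqI_generator_eq[where E = "range atMost" and \<Omega> = UNIV and A = "\<lambda>n. {..real n}"])
  show "Int_stable (range (atMost :: real \<Rightarrow> _))"
    by (auto simp: Int_stable_def)
  have "sets (borel :: real measure) = sigma_sets UNIV (range atMost)"
    by (subst borel_eq_atMost) (auto intro!: sets_measure_of)
  then show "sets M = sigma_sets UNIV (range atMost)" "sets N = sigma_sets UNIV (range atMost)"
    using assms by auto
  show "(\<Union>n. {..real n}) = UNIV"
    using real_arch_simple by auto
qed (use assms in auto)

text \<open>Continuity from below along the integers, extended to real \<open>t\<close> by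
  monotonicity. It evaluates the limits in \<open>embedded\<close>.\<close>

lemma (in finite_measure) tendsto_measure_and_le_at_top:
  fixes Y :: "'a \<Rightarrow> real"
  assumes [measurable]: "Measurable.pred M P" "Y \<in> borel_measurable M"
  shows "((\<lambda>t. measure M {\<omega> \<in> space M. P \<omega> \<and> Y \<omega> \<le> t}) \<longlongrightarrow> measure M {\<omega> \<in> space M. P \<omega>}) at_top"
proof (rule tendsto_at_topI_sequentially_real)
  show "mono (\<lambda>t. measure M {\<omega> \<in> space M. P \<omega> \<and> Y \<omega> \<le> t})"
    by (intro monoI finite_measure_mono) auto
  have "(\<lambda>n. measure M {\<omega> \<in> space M. P \<omega> \<and> Y \<omega> \<le> real n}) \<longlonglongrightarrow>
      measure M (\<Union>n. {\<omega> \<in> space M. P \<omega> \<and> Y \<omega> \<le> real n})"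
    by (intro finite_Lim_measure_incseq) (auto simp: incseq_def)
  moreover have "(\<Union>n. {\<omega> \<in> space M. P \<omega> \<and> Y \<omega> \<le> real n}) = {\<omega> \<in> space M. P \<omega>}"
    using real_arch_simple by auto
  ultimately show "(\<lambda>n. measure M {\<omega> \<in> space M. P \<omega> \<and> Y \<omega> \<le> real n}) \<longlonglongrightarrow>
      measure M {\<omega> \<in> space M. P \<omega>}"
    by simp
qed

context markov_renewal_process
begin

lemma J_count_space [measurable]: "J n \<in> M \<rightarrow>\<^sub>M count_space UNIV"
  using J_measurable[of n] by (rule measurable_compose) simp

lemma X_borel [measurable]: "X n \<in> borel_measurable M"
  using X_measurable[of n] by (simp add: measurable_restrict_space2_iff)

lemma borel_measurable_J: "(\<lambda>\<omega>. f (J n \<omega>)) \<in> borel_measurable M"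
  by (rule measurable_compose[OF J_count_space]) simp

lemma borel_measurable_pair:
  fixes f :: "nat \<Rightarrow> real \<Rightarrow> ennreal"
  assumes "\<And>j. f j \<in> borel_measurable borel"
  shows "(\<lambda>\<omega>. f (J n \<omega>) (X n \<omega>)) \<in> borel_measurable M"
  by (rule measurable_compose_countable[OF measurable_compose[OF X_borel assms] J_count_space])

lemma J_le: "\<omega> \<in> space M \<Longrightarrow> J n \<omega> \<le> m"
  using measurable_space[OF J_measurable, of \<omega> n] by simp

lemma X_nonneg: "\<omega> \<in> space M \<Longrightarrow> 0 \<le> X n \<omega>"
  using measurable_space[OF X_measurable, of \<omega> n] by (simp add: space_restrict_space)

lemma space_history [simp]: "space (history M m J X n) = space M"
  by (simp add: history_def)

lemma history_path:
  "(\<lambda>\<omega>. \<lambda>r\<in>{..n}. (J r \<omega>, X r \<omega>)) \<in> M \<rightarrow>\<^sub>M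
     (\<Pi>\<^sub>M r\<in>{..n}. count_space {0..m} \<Otimes>\<^sub>M (borel :: real measure))"
  by (intro measurable_restrict measurable_Pair J_measurable X_borel)

lemma subalgebra_history: "subalgebra M (history M m J X n)"
proof -
  have "(\<lambda>\<omega>. \<lambda>r\<in>{..n}. (J r \<omega>, X r \<omega>)) \<in> space M \<rightarrow>
      space (\<Pi>\<^sub>M r\<in>{..n}. count_space {0..m} \<Otimes>\<^sub>M (borel :: real measure))"
    using measurable_space[OF history_path] by blast
  then show ?thesis
    using measurable_sets[OF history_path[of n]]
    by (auto simp: subalgebra_def history_def sets_vimage_algebra2)
qed

lemma history_component:
  assumes "r \<le> n"
  shows "(\<lambda>\<omega>. (J r \<omega>, X r \<omega>)) \<in> history M m J X n \<rightarrow>\<^sub>M count_space {0..m} \<Otimes>\<^sub>M (borel :: real measure)"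
proof -
  have "(\<lambda>\<omega>. \<lambda>r\<in>{..n}. (J r \<omega>, X r \<omega>)) \<in> history M m J X n \<rightarrow>\<^sub>M
     (\<Pi>\<^sub>M r\<in>{..n}. count_space {0..m} \<Otimes>\<^sub>M (borel :: real measure))"
    unfolding history_def
    by (rule measurable_vimage_algebra1) (use measurable_space[OF history_path] in auto)
  from measurable_compose[OF this measurable_component_singleton[of r]] show ?thesis
    using assms by simp
qed

lemma J_history: "r \<le> n \<Longrightarrow> J r \<in> history M m J X n \<rightarrow>\<^sub>M count_space UNIV"
  using measurable_compose[OF measurable_compose[OF history_component measurable_fst], of r n "\<lambda>x. x"]
  by simp

lemma X_history: "r \<le> n \<Longrightarrow> X r \<in> borel_measurable (history M m J X n)"
  using measurable_compose[OF history_component measurable_snd, of r n] by simp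

lemma history_borel: "h \<in> borel_measurable (history M m J X n) \<Longrightarrow> h \<in> borel_measurable M"
  using subalgebra_history by (rule measurable_from_subalg)

lemma finite_measure_subalgebra_history: "finite_measure_subalgebra M (history M m J X n)"
  by unfold_locales (rule subalgebra_history)

text \<open>The defining property of conditional expectation, applied to the history set
  \<open>A\<close>, turns the almost sure statement \<open>markov\<close> into an equation between
  numbers.\<close>

lemma measure_step_le:
  assumes "A \<in> sets (history M m J X n)" "j \<in> {0..m}" "0 \<le> t"
  shows "measure M (A \<inter> {\<omega> \<in> space M. J (Suc n) \<omega> = j \<and> X (Suc n) \<omega> \<le> t}) =
    (\<integral>\<omega>\<in>A. Q (J n \<omega>) j t \<partial>M)"
proof -
  interpret H: finite_measure_subalgebra M "history M m J X n"
    by (rule finite_measure_subalgebra_history)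
  have [measurable]: "A \<in> sets M"
    using assms(1) subalgebra_history by (auto simp: subalgebra_def)
  let ?E = "{\<omega> \<in> space M. J (Suc n) \<omega> = j \<and> X (Suc n) \<omega> \<le> t}"
  have "measure M (A \<inter> ?E) = (\<integral>\<omega>\<in>A. indicator ?E \<omega> \<partial>M)"
    by (auto simp: set_lebesgue_integral_def indicator_inter_arith[symmetric])
  also have "\<dots> = (\<integral>\<omega>\<in>A. real_cond_exp M (history M m J X n) (indicator ?E) \<omega> \<partial>M)"
    by (rule H.real_cond_exp_intA[OF _ assms(1)])
      (auto intro!: integrable_real_indicator simp: emeasure_eq_measure)
  also have "\<dots> = (\<integral>\<omega>\<in>A. Q (J n \<omega>) j t \<partial>M)"
    unfolding set_lebesgue_integral_def
  proof (rule integral_cong_AE)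
    have "(\<lambda>\<omega>. Q (J n \<omega>) j t) \<in> borel_measurable M"
      by (rule measurable_compose[OF J_count_space]) simp
    then show "(\<lambda>\<omega>. indicator A \<omega> *\<^sub>R Q (J n \<omega>) j t) \<in> borel_measurable M"
      by measurable
    show "AE \<omega> in M. indicator A \<omega> *\<^sub>R real_cond_exp M (history M m J X n) (indicator ?E) \<omega> =
        indicator A \<omega> *\<^sub>R Q (J n \<omega>) j t"
      using markov[OF assms(2,3), of n] by eventually_elim simp
  qed simp
  finally show ?thesis .
qed

end

section \<open>Laws started in a fixed state and the one-step kernel\<close>

locale markov_renewal_family = markov_renewal_process M m p Q J X
  for M :: "'w measure" and m p Q J X +
  fixes P :: "nat \<Rightarrow> 'w measure"
  assumes process_from: "\<And>i. i \<in> {0..m} \<Longrightarrow>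
      markov_renewal_process (P i) m (\<lambda>j. if j = i then 1 else 0) Q J X"
begin

text \<open>This is the operator \<open>K\<close> of the Markov property. Integrating under
  \<open>P i\<close> avoids building a measure from the function \<open>Q i j\<close>; only values
  at states \<open>i \<le> m\<close> have this meaning.\<close>

definition kernel :: "(nat \<Rightarrow> real \<Rightarrow> ennreal) \<Rightarrow> nat \<Rightarrow> ennreal" where
  "kernel g i = (\<integral>\<^sup>+\<omega>. g (J 1 \<omega>) (X 1 \<omega>) \<partial>P i)"

lemma family_from: "i \<in> {0..m} \<Longrightarrow> markov_renewal_family (P i) m (\<lambda>j. if j = i then 1 else 0) Q J X P"
  using process_from by (simp add: markov_renewal_family_def markov_renewal_family_axioms_def)

lemma AE_from_J0:
  assumes i: "i \<in> {0..m}"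
  shows "AE \<omega> in P i. J 0 \<omega> = i"
proof -
  interpret Pi: markov_renewal_process "P i" m "\<lambda>j. if j = i then 1 else 0" Q J X
    by (rule process_from[OF i])
  show ?thesis
    using Pi.initial_state[OF i] by (subst Pi.prob_Collect_eq_1[symmetric]) auto
qed

text \<open>This is the Markov property at time 0, with the whole space as history event and
  \<open>J 0 = i\<close> almost surely. It ties the abstract function \<open>Q\<close> to the law of
  the first jump.\<close>

lemma Q_eq:
  assumes i: "i \<in> {0..m}" and j: "j \<in> {0..m}" and t: "0 \<le> t"
  shows "Q i j t = measure (P i) {\<omega> \<in> space (P i). J 1 \<omega> = j \<and> X 1 \<omega> \<le> t}"
proof -
  interpret Pi: markov_renewal_process "P i" m "\<lambda>j. if j = i then 1 else 0" Q J X
    by (rule process_from[OF i])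
  have "space (P i) \<in> sets (history (P i) m J X 0)"
    using sets.top[of "history (P i) m J X 0"] by simp
  from Pi.measure_step_le[OF this j t]
  have "measure (P i) {\<omega> \<in> space (P i). J 1 \<omega> = j \<and> X 1 \<omega> \<le> t} =
      (\<integral>\<omega>\<in>space (P i). Q (J 0 \<omega>) j t \<partial>P i)"
    by (simp add: Int_def cong: conj_cong)
  also have "\<dots> = (\<integral>\<omega>. Q i j t \<partial>P i)"
    unfolding set_lebesgue_integral_def
  proof (rule integral_cong_AE)
    show "(\<lambda>\<omega>. indicator (space (P i)) \<omega> *\<^sub>R Q (J 0 \<omega>) j t) \<in> borel_measurable (P i)"
      using measurable_compose[OF Pi.J_count_space, of "\<lambda>i. Q i j t" borel 0] by measurable
    show "AE \<omega> in P i. indicator (space (P i)) \<omega> *\<^sub>R Q (J 0 \<omega>) j t = Q i j t"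
      using AE_from_J0[OF i] AE_space by eventually_elim simp
  qed simp
  finally show ?thesis
    by (simp add: Pi.prob_space)
qed

lemma embedded_eq:
  assumes i: "i \<in> {0..m}" and j: "j \<in> {0..m}"
  shows "embedded Q i j = measure (P i) {\<omega> \<in> space (P i). J 1 \<omega> = j}"
proof -
  interpret Pi: markov_renewal_process "P i" m "\<lambda>j. if j = i then 1 else 0" Q J X
    by (rule process_from[OF i])
  have "((\<lambda>t. measure (P i) {\<omega> \<in> space (P i). J 1 \<omega> = j \<and> X 1 \<omega> \<le> t}) \<longlongrightarrow>
      measure (P i) {\<omega> \<in> space (P i). J 1 \<omega> = j}) at_top"
    by (rule Pi.tendsto_measure_and_le_at_top) auto
  \<comment> \<open>\<open>Q_eq\<close> speaks of \<open>t \<ge> 0\<close> only, which is enough for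
    a limit at infinity.\<close>
  then have "(Q i j \<longlongrightarrow> measure (P i) {\<omega> \<in> space (P i). J 1 \<omega> = j}) at_top"
    by (rule Lim_transform_eventually)
      (use eventually_ge_at_top[of 0] in eventually_elim, simp add: Q_eq[OF i j])
  then show ?thesis
    unfolding embedded_def by (intro tendsto_Lim) auto
qed

text \<open>Both sides integrate \<open>g\<close> against finite measures on the line: the law of
  the next jump restricted to \<open>A\<close> and to next state \<open>j\<close>, and a multiple of
  the corresponding law under \<open>P i\<close>. These agree on half-lines by
  \<open>measure_step_le\<close> and \<open>Q_eq\<close>, hence everywhere.\<close>

lemma nn_integral_step_single:
  assumes A: "A \<in> sets (history M m J X n)" and i: "i \<in> {0..m}" and j: "j \<in> {0..m}"
    and Ai: "\<And>\<omega>. \<omega> \<in> A \<Longrightarrow> J n \<omega> = i" and g: "g \<in> borel_measurable borel"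
  shows "(\<integral>\<^sup>+\<omega>. indicator A \<omega> * (indicator {j} (J (Suc n) \<omega>) * g (X (Suc n) \<omega>)) \<partial>M) =
    emeasure M A * (\<integral>\<^sup>+\<omega>. indicator {j} (J 1 \<omega>) * g (X 1 \<omega>) \<partial>P i)"
proof -
  interpret Pi: markov_renewal_process "P i" m "\<lambda>j. if j = i then 1 else 0" Q J X
    by (rule process_from[OF i])
  note g [measurable]
  have [measurable]: "A \<in> sets M"
    using A subalgebra_history by (auto simp: subalgebra_def)
  let ?f = "\<lambda>\<omega>. indicator A \<omega> * indicator {j} (J (Suc n) \<omega>) :: ennreal"
  let ?f' = "\<lambda>\<omega>. indicator {j} (J 1 \<omega>) :: ennreal"
  have [measurable]: "?f \<in> borel_measurable M" "?f' \<in> borel_measurable (P i)"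
    by (auto intro!: borel_measurable_times_ennreal borel_measurable_indicator
        intro: borel_measurable_J Pi.borel_measurable_J)
  let ?N = "distr (density M ?f) borel (X (Suc n))"
  let ?N' = "distr (density (P i) ?f') borel (X 1)"
  have N: "emeasure ?N {..t} = emeasure M (A \<inter> {\<omega> \<in> space M. J (Suc n) \<omega> = j \<and> X (Suc n) \<omega> \<le> t})" for t
  proof -
    have "emeasure ?N {..t} = (\<integral>\<^sup>+\<omega>. ?f \<omega> * indicator (X (Suc n) -` {..t} \<inter> space M) \<omega> \<partial>M)"
      by (simp add: emeasure_distr emeasure_density del: One_nat_def)
    also have "\<dots> = (\<integral>\<^sup>+\<omega>. indicator (A \<inter> {\<omega> \<in> space M. J (Suc n) \<omega> = j \<and> X (Suc n) \<omega> \<le> t}) \<omega> \<partial>M)"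
      by (rule nn_integral_cong) (auto split: split_indicator)
    finally show ?thesis
      by simp
  qed
  have N': "emeasure ?N' {..t} = emeasure (P i) {\<omega> \<in> space (P i). J 1 \<omega> = j \<and> X 1 \<omega> \<le> t}" for t
  proof -
    have "emeasure ?N' {..t} = (\<integral>\<^sup>+\<omega>. ?f' \<omega> * indicator (X 1 -` {..t} \<inter> space (P i)) \<omega> \<partial>P i)"
      by (simp add: emeasure_distr emeasure_density del: One_nat_def)
    also have "\<dots> = (\<integral>\<^sup>+\<omega>. indicator ({\<omega> \<in> space (P i). J 1 \<omega> = j \<and> X 1 \<omega> \<le> t}) \<omega> \<partial>P i)"
      by (rule nn_integral_cong) (auto split: split_indicator)
    finally show ?thesis
      by simp
  qed
  have "?N = scale_measure (emeasure M A) ?N'"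
  proof (rule measure_eqI_atMost)
    fix t :: real
    show "emeasure ?N {..t} \<noteq> \<infinity>"
      unfolding N by (simp add: emeasure_eq_measure)
    show "emeasure ?N {..t} = emeasure (scale_measure (emeasure M A) ?N') {..t}"
    proof (cases "0 \<le> t")
      case True
      have "measure M (A \<inter> {\<omega> \<in> space M. J (Suc n) \<omega> = j \<and> X (Suc n) \<omega> \<le> t}) =
          (\<integral>\<omega>\<in>A. Q (J n \<omega>) j t \<partial>M)"
        by (rule measure_step_le[OF A j True])
      also have "\<dots> = (\<integral>\<omega>\<in>A. Q i j t \<partial>M)"
        by (rule set_lebesgue_integral_cong) (auto simp: Ai)
      also have "\<dots> = measure M A * Q i j t"
        by (simp add: set_lebesgue_integral_def)
      finally show ?thesis
        unfolding emeasure_scale_measure N N'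
        by (simp add: emeasure_eq_measure Pi.emeasure_eq_measure Q_eq[OF i j True] ennreal_mult)
    next
      \<comment> \<open>The assumption \<open>markov\<close> is silent for negative
        \<open>t\<close>; here both events are empty because jumps are nonnegative.\<close>
      case False
      then have empty: "{\<omega> \<in> space M. J (Suc n) \<omega> = j \<and> X (Suc n) \<omega> \<le> t} = {}"
        "{\<omega> \<in> space (P i). J 1 \<omega> = j \<and> X 1 \<omega> \<le> t} = {}"
        using order_trans[OF X_nonneg, of _ "Suc n" t] order_trans[OF Pi.X_nonneg, of _ 1 t] by blast+
      show ?thesis
        unfolding emeasure_scale_measure N N' empty by simp
    qed
  qed simp_all
  then have "nn_integral ?N g = emeasure M A * nn_integral ?N' g"
    by (simp add: nn_integral_scale_measure)
  then show ?thesis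
    by (simp add: nn_integral_distr nn_integral_density mult.assoc del: One_nat_def)
qed

lemma kernel_sum:
  assumes i: "i \<in> {0..m}" and g[measurable]: "\<And>j. g j \<in> borel_measurable borel"
  shows "kernel g i = (\<Sum>j\<in>{0..m}. \<integral>\<^sup>+\<omega>. indicator {j} (J 1 \<omega>) * g j (X 1 \<omega>) \<partial>P i)"
proof -
  interpret Pi: markov_renewal_process "P i" m "\<lambda>j. if j = i then 1 else 0" Q J X
    by (rule process_from[OF i])
  have *: "kernel g i = (\<integral>\<^sup>+\<omega>. (\<Sum>j\<in>{0..m}. indicator {j} (J 1 \<omega>) * g j (X 1 \<omega>)) \<partial>P i)"
    unfolding kernel_def
    by (rule nn_integral_cong) (use Pi.J_le in \<open>simp add: indicator_def if_distrib sum.If_cases cong: if_cong\<close>)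
  show ?thesis
    unfolding * by (rule nn_integral_sum, rule Pi.borel_measurable_pair) (use g in auto)
qed

text \<open>\<open>kernel g (J n \<omega>)\<close> is a version of the conditional expectation of
  the next-jump function given the history: a history set is split by the present and the next
  state, and \<open>nn_integral_step_single\<close> applies to each piece. The history-measurable
  weight \<open>h\<close> can then be pulled out.\<close>

lemma nn_integral_step:
  assumes h: "h \<in> borel_measurable (history M m J X n)"
    and g: "\<And>j. g j \<in> borel_measurable borel"
  shows "(\<integral>\<^sup>+\<omega>. h \<omega> * g (J (Suc n) \<omega>) (X (Suc n) \<omega>) \<partial>M) = (\<integral>\<^sup>+\<omega>. h \<omega> * kernel g (J n \<omega>) \<partial>M)"
proof -
  interpret H: finite_measure_subalgebra M "history M m J X n"
    by (rule finite_measure_subalgebra_history)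
  note g [measurable]
  let ?F = "history M m J X n"
  let ?f = "\<lambda>\<omega>. g (J (Suc n) \<omega>) (X (Suc n) \<omega>)"
  have f [measurable]: "?f \<in> borel_measurable M"
    by (rule borel_measurable_pair) (rule g)
  have K [measurable]: "(\<lambda>\<omega>. kernel g (J n \<omega>)) \<in> borel_measurable ?F"
    by (rule measurable_compose[OF J_history]) auto
  have K' [measurable]: "(\<lambda>\<omega>. kernel g (J n \<omega>)) \<in> borel_measurable M"
    using K by (rule history_borel)
  have "(\<integral>\<^sup>+\<omega>\<in>A. ?f \<omega> \<partial>M) = (\<integral>\<^sup>+\<omega>\<in>A. kernel g (J n \<omega>) \<partial>M)" if A: "A \<in> sets ?F" for A
  proof -
    have [measurable]: "A \<in> sets M"
      using A subalgebra_history by (auto simp: subalgebra_def)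
    let ?A = "\<lambda>i. A \<inter> (J n -` {i} \<inter> space M)"
    have Ai: "?A i \<in> sets ?F" for i
      using sets.Int[OF A measurable_sets[OF J_history[of n n], of "{i}"]] by simp
    have meas: "(\<lambda>\<omega>. indicator (?A i) \<omega> * (indicator {j} (J (Suc n) \<omega>) * g j (X (Suc n) \<omega>)))
        \<in> borel_measurable M" for i j
    proof (intro borel_measurable_times_ennreal)
      show "indicator (?A i) \<in> borel_measurable M"
        by (rule borel_measurable_indicator) auto
    qed (auto intro: borel_measurable_J)
    have "(\<integral>\<^sup>+\<omega>\<in>A. ?f \<omega> \<partial>M) = (\<integral>\<^sup>+\<omega>. (\<Sum>i\<in>{0..m}. \<Sum>j\<in>{0..m}.
        indicator (?A i) \<omega> * (indicator {j} (J (Suc n) \<omega>) * g j (X (Suc n) \<omega>))) \<partial>M)"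
    proof (rule nn_integral_cong)
      fix \<omega> assume \<omega>: "\<omega> \<in> space M"
      have "(\<Sum>i\<in>{0..m}. \<Sum>j\<in>{0..m}.
          indicator (?A i) \<omega> * (indicator {j} (J (Suc n) \<omega>) * g j (X (Suc n) \<omega>))) =
        (\<Sum>i\<in>{0..m}. indicator (?A i) \<omega>) * (\<Sum>j\<in>{0..m}. indicator {j} (J (Suc n) \<omega>) * g j (X (Suc n) \<omega>))"
        by (simp add: sum_product)
      moreover have "(\<Sum>i\<in>{0..m}. indicator (?A i) \<omega>) = (indicator A \<omega> :: ennreal)"
        using \<omega> J_le[of \<omega> n] by (simp add: indicator_def sum.If_cases)
      moreover have "(\<Sum>j\<in>{0..m}. indicator {j} (J (Suc n) \<omega>) * g j (X (Suc n) \<omega>)) = ?f \<omega>"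
        using J_le[OF \<omega>] by (simp add: indicator_def if_distrib sum.If_cases cong: if_cong)
      ultimately show "?f \<omega> * indicator A \<omega> = (\<Sum>i\<in>{0..m}. \<Sum>j\<in>{0..m}.
          indicator (?A i) \<omega> * (indicator {j} (J (Suc n) \<omega>) * g j (X (Suc n) \<omega>)))"
        by (simp add: mult.commute)
    qed
    also have "\<dots> = (\<Sum>i\<in>{0..m}. \<Sum>j\<in>{0..m}. \<integral>\<^sup>+\<omega>.
        indicator (?A i) \<omega> * (indicator {j} (J (Suc n) \<omega>) * g j (X (Suc n) \<omega>)) \<partial>M)"
      by (simp only: nn_integral_sum borel_measurable_sum meas)
    also have "\<dots> = (\<Sum>i\<in>{0..m}. \<Sum>j\<in>{0..m}.
        emeasure M (?A i) * (\<integral>\<^sup>+\<omega>. indicator {j} (J 1 \<omega>) * g j (X 1 \<omega>) \<partial>P i))"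
      by (intro sum.cong nn_integral_step_single Ai g) auto
    also have "\<dots> = (\<Sum>i\<in>{0..m}. kernel g i * emeasure M (?A i))"
      by (simp add: kernel_sum sum_distrib_left mult.commute)
    also have "\<dots> = (\<integral>\<^sup>+\<omega>. (\<Sum>i\<in>{0..m}. kernel g i * indicator (?A i) \<omega>) \<partial>M)"
    proof (subst nn_integral_sum)
      show "(\<lambda>\<omega>. kernel g i * indicator (?A i) \<omega>) \<in> borel_measurable M" for i
        by (intro borel_measurable_times_ennreal borel_measurable_indicator) auto
    qed (auto intro!: sum.cong nn_integral_cmult_indicator[symmetric])
    also have "\<dots> = (\<integral>\<^sup>+\<omega>\<in>A. kernel g (J n \<omega>) \<partial>M)"
    proof (rule nn_integral_cong)
      fix \<omega> assume "\<omega> \<in> space M"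
      then show "(\<Sum>i\<in>{0..m}. kernel g i * indicator (?A i) \<omega>) = kernel g (J n \<omega>) * indicator A \<omega>"
        using J_le[of \<omega> n] by (simp add: indicator_def if_distrib sum.If_cases cong: if_cong)
    qed
    finally show ?thesis .
  qed
  then have *: "AE \<omega> in M. kernel g (J n \<omega>) = nn_cond_exp M ?F ?f \<omega>"
    by (intro H.nn_cond_exp_charact) auto
  have "(\<integral>\<^sup>+\<omega>. h \<omega> * ?f \<omega> \<partial>M) = (\<integral>\<^sup>+\<omega>. h \<omega> * nn_cond_exp M ?F ?f \<omega> \<partial>M)"
    by (rule H.nn_cond_exp_intg[symmetric, OF h f])
  also have "\<dots> = (\<integral>\<^sup>+\<omega>. h \<omega> * kernel g (J n \<omega>) \<partial>M)"
    by (rule nn_integral_cong_AE) (use * in eventually_elim, simp)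
  finally show ?thesis .
qed

end

section \<open>Staying in a set of states\<close>

text \<open>Each of infinitely many jumps adds more than \<open>\<epsilon>\<close> and no jump
  subtracts, so every multiple of \<open>\<epsilon>\<close> is reached.\<close>

lemma renewal_time_unbounded:
  assumes nonneg: "\<And>n. 0 \<le> X n \<omega>" and "0 < \<epsilon>" and often: "\<And>n. \<exists>s>n. \<epsilon> < X s \<omega>"
  shows "\<exists>n. t < renewal_time X n \<omega>"
proof -
  have "\<exists>n. real l * \<epsilon> \<le> renewal_time X n \<omega>" for l
  proof (induction l)
    case 0
    show ?case
      by (rule exI[of _ 0]) (simp add: renewal_time_def)
  next
    case (Suc l)
    then obtain n where n: "real l * \<epsilon> \<le> renewal_time X n \<omega>" by blast
    obtain s where s: "s > n" "\<epsilon> < X s \<omega>" using often by blast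
    have "(\<Sum>r\<in>insert s {1..n}. X r \<omega>) \<le> (\<Sum>r=1..s. X r \<omega>)"
      by (rule sum_mono2) (use s nonneg in auto)
    with n s show ?case
      by (intro exI[of _ s]) (simp add: renewal_time_def algebra_simps)
  qed
  moreover obtain l where "t < real l * \<epsilon>"
    using \<open>0 < \<epsilon>\<close> reals_Archimedean3 by blast
  ultimately show ?thesis
    by (meson less_le_trans)
qed

context markov_renewal_process
begin

lemma history_mono:
  assumes h: "h \<in> borel_measurable (history M m J X n)" and "n \<le> n'"
  shows "h \<in> borel_measurable (history M m J X n')"
proof -
  have "(\<lambda>\<omega>. \<omega>) \<in> history M m J X n' \<rightarrow>\<^sub>M history M m J X n"
    unfolding history_def[of M m J X n]
  proof (rule measurable_vimage_algebra2)
    show "(\<lambda>\<omega>. \<lambda>r\<in>{..n}. (J r \<omega>, X r \<omega>)) \<in> history M m J X n' \<rightarrow>\<^sub>M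
        (\<Pi>\<^sub>M r\<in>{..n}. count_space {0..m} \<Otimes>\<^sub>M borel)"
      by (intro measurable_restrict history_component) (use \<open>n \<le> n'\<close> in auto)
  qed simp
  from measurable_compose[OF this h] show ?thesis .
qed

text \<open>The indicator is a finite product of functions of single pairs at epochs
  \<open>s \<le> n\<close>. Taking \<open>UNIV\<close> for \<open>B\<close> or for \<open>G\<close>
  gives events about states alone or jumps alone.\<close>

lemma history_indicator:
  assumes "I \<subseteq> {..n}" "B \<in> sets borel"
  shows "indicator {\<omega>. \<forall>s\<in>I. J s \<omega> \<in> G \<and> X s \<omega> \<in> B} \<in>
    (borel_measurable (history M m J X n) :: ('w \<Rightarrow> ennreal) set)"
proof -
  have "finite I"
    using assms(1) by (rule finite_subset) simp
  then have "indicator {\<omega>. \<forall>s\<in>I. J s \<omega> \<in> G \<and> X s \<omega> \<in> B} \<omega> =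
      (\<Prod>s\<in>I. indicator G (J s \<omega>) * indicator B (X s \<omega>) :: ennreal)" for \<omega>
    by induction (auto simp: indicator_def)
  moreover have "(\<lambda>\<omega>. \<Prod>s\<in>I. indicator G (J s \<omega>) * indicator B (X s \<omega>) :: ennreal)
      \<in> borel_measurable (history M m J X n)"
  proof (intro borel_measurable_prod_ennreal borel_measurable_times_ennreal)
    fix s assume "s \<in> I"
    then have "s \<le> n" using assms(1) by auto
    show "(\<lambda>\<omega>. indicator G (J s \<omega>) :: ennreal) \<in> borel_measurable (history M m J X n)"
      by (rule measurable_compose[OF J_history[OF \<open>s \<le> n\<close>]]) simp
    show "(\<lambda>\<omega>. indicator B (X s \<omega>) :: ennreal) \<in> borel_measurable (history M m J X n)"
      by (rule measurable_compose[OF X_history[OF \<open>s \<le> n\<close>] borel_measurable_indicator[OF assms(2)]])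
  qed
  ultimately show ?thesis
    by presburger
qed

end

context markov_renewal_family
begin

text \<open>For the indicator of the exceptional set the kernel vanishes at every state, so the
  expected violation at the next jump is zero. This carries properties of the first jump, known for
  all starting states, to every later jump.\<close>

lemma AE_step:
  assumes \<phi>: "\<And>j. Measurable.pred borel (\<phi> j)"
    and AE: "\<And>i. i \<in> {0..m} \<Longrightarrow> AE \<omega> in P i. \<phi> (J 1 \<omega>) (X 1 \<omega>)"
  shows "AE \<omega> in M. \<phi> (J (Suc n) \<omega>) (X (Suc n) \<omega>)"
proof -
  let ?g = "\<lambda>j x. indicator {x. \<not> \<phi> j x} x :: ennreal"
  have g: "?g j \<in> borel_measurable borel" for j
    using \<phi> by (intro borel_measurable_indicator) (simp add: pred_def Collect_neg_eq)
  have "kernel ?g i = 0" if "i \<in> {0..m}" for i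
  proof -
    have "kernel ?g i = (\<integral>\<^sup>+\<omega>. 0 \<partial>P i)"
      unfolding kernel_def
      by (rule nn_integral_cong_AE) (use AE[OF that] in eventually_elim, simp)
    then show ?thesis
      by simp
  qed
  then have "(\<integral>\<^sup>+\<omega>. 1 * kernel ?g (J n \<omega>) \<partial>M) = (\<integral>\<^sup>+\<omega>. 0 \<partial>M)"
    by (intro nn_integral_cong) (simp add: J_le)
  then have "(\<integral>\<^sup>+\<omega>. ?g (J (Suc n) \<omega>) (X (Suc n) \<omega>) \<partial>M) = 0"
    using nn_integral_step[of "\<lambda>_. 1" n ?g] g by simp
  then show ?thesis
    using borel_measurable_pair[of ?g, OF g] 
    by (subst (asm) nn_integral_0_iff_AE) (auto simp: indicator_def split: if_splits)
qed

text \<open>The kernel is bounded only where the weight \<open>h\<close> is nonzero, so a weight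
  that vanishes outside a set of states allows a bound valid in that set alone.\<close>

lemma nn_integral_step_le:
  assumes h: "h \<in> borel_measurable (history M m J X n)"
    and g: "\<And>j. g j \<in> borel_measurable borel"
    and le: "\<And>\<omega>. \<omega> \<in> space M \<Longrightarrow> h \<omega> \<noteq> 0 \<Longrightarrow> kernel g (J n \<omega>) \<le> c"
  shows "(\<integral>\<^sup>+\<omega>. h \<omega> * g (J (Suc n) \<omega>) (X (Suc n) \<omega>) \<partial>M) \<le> c * (\<integral>\<^sup>+\<omega>. h \<omega> \<partial>M)"
proof -
  have "(\<integral>\<^sup>+\<omega>. h \<omega> * kernel g (J n \<omega>) \<partial>M) \<le> (\<integral>\<^sup>+\<omega>. c * h \<omega> \<partial>M)"
  proof (rule nn_integral_mono)
    fix \<omega> assume "\<omega> \<in> space M"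
    then show "h \<omega> * kernel g (J n \<omega>) \<le> c * h \<omega>"
      using le[of \<omega>] by (cases "h \<omega> = 0") (auto simp: mult.commute[of c] intro!: mult_left_mono)
  qed
  also have "\<dots> = c * (\<integral>\<^sup>+\<omega>. h \<omega> \<partial>M)"
    by (rule nn_integral_cmult) (rule history_borel[OF h])
  finally show ?thesis
    unfolding nn_integral_step[of h n g, OF h g] .
qed

text \<open>Induction on \<open>l\<close> with one factor \<open>c\<close> per step: the weight
  accumulated up to time \<open>n + l\<close> is supported where the chain is still in
  \<open>G\<close>, so the one-step bound applies again. The general weight \<open>h\<close> lets
  the estimate carry a power of an earlier jump.\<close>

lemma nn_integral_stay_le:
  assumes h: "h \<in> borel_measurable (history M m J X n)"
    and supp: "\<And>\<omega>. h \<omega> \<noteq> 0 \<Longrightarrow> J n \<omega> \<in> G"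
    and B: "B \<in> sets borel"
    and c: "\<And>i. i \<in> G \<Longrightarrow> i \<in> {0..m} \<Longrightarrow>
      emeasure (P i) {\<omega> \<in> space (P i). J 1 \<omega> \<in> G \<and> X 1 \<omega> \<in> B} \<le> c"
  shows "(\<integral>\<^sup>+\<omega>. h \<omega> * indicator {\<omega>. \<forall>s\<in>{n<..n + l}. J s \<omega> \<in> G \<and> X s \<omega> \<in> B} \<omega> \<partial>M)
    \<le> c ^ l * (\<integral>\<^sup>+\<omega>. h \<omega> \<partial>M)"
proof (induction l)
  case 0
  show ?case by simp
next
  case (Suc l)
  let ?I = "\<lambda>l. indicator {\<omega>. \<forall>s\<in>{n<..n + l}. J s \<omega> \<in> G \<and> X s \<omega> \<in> B} :: 'w \<Rightarrow> ennreal"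
  let ?g = "\<lambda>j x. indicator G j * indicator B x :: ennreal"
  have I: "?I (Suc l) \<omega> = ?I l \<omega> * ?g (J (Suc (n + l)) \<omega>) (X (Suc (n + l)) \<omega>)" for \<omega>
  proof -
    have "{n<..n + Suc l} = insert (Suc (n + l)) {n<..n + l}"
      by auto
    then show ?thesis
      by (auto simp: indicator_def)
  qed
  have kernel: "kernel ?g i \<le> c" if i: "i \<in> G" "i \<in> {0..m}" for i
  proof -
    interpret Pi: markov_renewal_process "P i" m "\<lambda>j. if j = i then 1 else 0" Q J X
      by (rule process_from[OF i(2)])
    note B [measurable]
    have "kernel ?g i = (\<integral>\<^sup>+\<omega>. indicator {\<omega> \<in> space (P i). J 1 \<omega> \<in> G \<and> X 1 \<omega> \<in> B} \<omega> \<partial>P i)"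
      unfolding kernel_def by (rule nn_integral_cong) (auto simp: indicator_def)
    also have "\<dots> = emeasure (P i) {\<omega> \<in> space (P i). J 1 \<omega> \<in> G \<and> X 1 \<omega> \<in> B}"
      by (rule nn_integral_indicator) measurable
    finally show ?thesis
      using c[OF i] by simp
  qed
  have "(\<integral>\<^sup>+\<omega>. h \<omega> * ?I (Suc l) \<omega> \<partial>M) =
      (\<integral>\<^sup>+\<omega>. (h \<omega> * ?I l \<omega>) * ?g (J (Suc (n + l)) \<omega>) (X (Suc (n + l)) \<omega>) \<partial>M)"
    by (simp only: I mult.assoc)
  also have "\<dots> \<le> c * (\<integral>\<^sup>+\<omega>. h \<omega> * ?I l \<omega> \<partial>M)"
  proof (rule nn_integral_step_le)
    show "(\<lambda>\<omega>. h \<omega> * ?I l \<omega>) \<in> borel_measurable (history M m J X (n + l))"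
      by (intro borel_measurable_times_ennreal history_indicator B history_mono[OF h]) auto
    show "?g j \<in> borel_measurable borel" for j
      using B by measurable
    fix \<omega> assume "\<omega> \<in> space M" "h \<omega> * ?I l \<omega> \<noteq> 0"
    \<comment> \<open>For \<open>l = 0\<close> this comes from the support of \<open>h\<close>, for
      larger \<open>l\<close> from the indicator at \<open>s = n + l\<close>.\<close>
    then have "J (n + l) \<omega> \<in> G"
      using supp[of \<omega>] by (cases "l = 0") (auto simp: indicator_def split: if_splits)
    then show "kernel ?g (J (n + l) \<omega>) \<le> c"
      using J_le[OF \<open>\<omega> \<in> space M\<close>] by (intro kernel) auto
  qed
  also have "\<dots> \<le> c * (c ^ l * (\<integral>\<^sup>+\<omega>. h \<omega> \<partial>M))"
    by (intro mult_left_mono Suc.IH) simp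
  finally show ?case
    by (simp add: mult.assoc)
qed

text \<open>Staying forever implies staying for \<open>l\<close> steps, which has probability at
  most \<open>c ^ l\<close>; this holds for every \<open>l\<close>, and \<open>c ^ l\<close> tends
  to zero.\<close>

lemma AE_leave:
  fixes c :: real
  assumes B: "B \<in> sets borel" and c01: "0 \<le> c" "c < 1"
    and c: "\<And>i. i \<in> G \<Longrightarrow> i \<in> {0..m} \<Longrightarrow>
      measure (P i) {\<omega> \<in> space (P i). J 1 \<omega> \<in> G \<and> X 1 \<omega> \<in> B} \<le> c"
  shows "AE \<omega> in M. \<not> (J n \<omega> \<in> G \<and> (\<forall>s>n. J s \<omega> \<in> G \<and> X s \<omega> \<in> B))"
proof -
  note B [measurable]
  let ?E = "{\<omega> \<in> space M. J n \<omega> \<in> G \<and> (\<forall>s>n. J s \<omega> \<in> G \<and> X s \<omega> \<in> B)}"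
  let ?h = "indicator {\<omega>. \<forall>s\<in>{n}. J s \<omega> \<in> G \<and> X s \<omega> \<in> UNIV} :: 'w \<Rightarrow> ennreal"
  have h: "?h \<in> borel_measurable (history M m J X n)"
    by (rule history_indicator) auto
  have "measure M ?E \<le> c ^ l" for l
  proof -
    have "emeasure M ?E = (\<integral>\<^sup>+\<omega>. indicator ?E \<omega> \<partial>M)"
      by (rule nn_integral_indicator[symmetric]) measurable
    also have "\<dots> \<le> (\<integral>\<^sup>+\<omega>. ?h \<omega> * indicator {\<omega>. \<forall>s\<in>{n<..n + l}. J s \<omega> \<in> G \<and> X s \<omega> \<in> B} \<omega> \<partial>M)"
      by (rule nn_integral_mono) (auto simp: indicator_def)
    also have "\<dots> \<le> ennreal c ^ l * (\<integral>\<^sup>+\<omega>. ?h \<omega> \<partial>M)"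
    proof (rule nn_integral_stay_le[OF h _ B])
      fix i assume i: "i \<in> G" "i \<in> {0..m}"
      interpret Pi: markov_renewal_process "P i" m "\<lambda>j. if j = i then 1 else 0" Q J X
        by (rule process_from[OF i(2)])
      show "emeasure (P i) {\<omega> \<in> space (P i). J 1 \<omega> \<in> G \<and> X 1 \<omega> \<in> B} \<le> ennreal c"
        unfolding Pi.emeasure_eq_measure by (rule ennreal_leI[OF c[OF i]])
    qed (auto simp: indicator_def split: if_splits)
    also have "(\<integral>\<^sup>+\<omega>. ?h \<omega> \<partial>M) \<le> (\<integral>\<^sup>+\<omega>. 1 \<partial>M)"
      by (rule nn_integral_mono) (auto simp: indicator_def)
    then have "ennreal c ^ l * (\<integral>\<^sup>+\<omega>. ?h \<omega> \<partial>M) \<le> ennreal c ^ l * 1"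
      by (intro mult_left_mono) (simp_all add: emeasure_space_1)
    finally show ?thesis
      using c01 by (simp add: emeasure_eq_measure ennreal_power)
  qed
  moreover have "(\<lambda>l. c ^ l) \<longlonglongrightarrow> 0"
    using c01 by (intro LIMSEQ_realpow_zero) auto
  ultimately have "measure M ?E \<le> 0"
    by (intro LIMSEQ_le_const[of "\<lambda>l. c ^ l"]) auto
  then have "measure M ?E = 0"
    using measure_nonneg[of M ?E] by linarith
  then show ?thesis
    by (subst (asm) prob_Collect_eq_0) auto
qed

section \<open>Positive jumps, unbounded renewal times and infinitely many visits\<close>

lemma AE_X_pos_from:
  assumes i: "i \<in> {0..m}" and B: "\<forall>i\<in>{0..m}. \<forall>j\<in>{0..m}. Q i j 0 = 0"
  shows "AE \<omega> in P i. 0 < X 1 \<omega>"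
proof -
  interpret Pi: markov_renewal_process "P i" m "\<lambda>j. if j = i then 1 else 0" Q J X
    by (rule process_from[OF i])
  have "AE \<omega> in P i. \<not> (J 1 \<omega> = j \<and> X 1 \<omega> \<le> 0)" if "j \<in> {0..m}" for j
    using Q_eq[OF i that, of 0] B i that by (subst Pi.prob_Collect_eq_0[symmetric]) auto
  then have "AE \<omega> in P i. \<forall>j\<in>{0..m}. \<not> (J 1 \<omega> = j \<and> X 1 \<omega> \<le> 0)"
    by (intro AE_finite_allI) auto
  then show ?thesis
    using AE_space by eventually_elim (use Pi.J_le in force)
qed

lemma AE_X_pos:
  assumes B: "\<forall>i\<in>{0..m}. \<forall>j\<in>{0..m}. Q i j 0 = 0"
  shows "AE \<omega> in M. \<forall>n\<ge>1. 0 < X n \<omega>"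
proof -
  have "AE \<omega> in M. 0 < X (Suc n) \<omega>" for n
    by (rule AE_step[of "\<lambda>_ x. 0 < x"]) (auto intro: AE_X_pos_from[OF _ B, simplified])
  then have "AE \<omega> in M. \<forall>n. 0 < X (Suc n) \<omega>"
    by (simp add: AE_all_countable)
  then show ?thesis
    by eventually_elim (metis One_nat_def Suc_le_D)
qed

text \<open>For each starting state the events \<open>X 1 \<omega> \<le> 1 / (n + 1)\<close>
  decrease to a null event, and finitely many states admit a common \<open>n\<close>. Any constant
  in the open interval from 0 to 1 would serve in place of \<open>1 / 2\<close>.\<close>

lemma ex_small_jump:
  assumes B: "\<forall>i\<in>{0..m}. \<forall>j\<in>{0..m}. Q i j 0 = 0"
  shows "\<exists>\<epsilon>>0. \<forall>i\<in>{0..m}. measure (P i) {\<omega> \<in> space (P i). X 1 \<omega> \<le> \<epsilon>} \<le> 1 / 2"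
proof -
  have "eventually (\<lambda>n. measure (P i) {\<omega> \<in> space (P i). X 1 \<omega> \<le> inverse (real (Suc n))} < 1 / 2) sequentially"
    if i: "i \<in> {0..m}" for i
  proof -
    interpret Pi: markov_renewal_process "P i" m "\<lambda>j. if j = i then 1 else 0" Q J X
      by (rule process_from[OF i])
    let ?A = "\<lambda>n. {\<omega> \<in> space (P i). X 1 \<omega> \<le> inverse (real (Suc n))}"
    have "(\<lambda>n. measure (P i) (?A n)) \<longlonglongrightarrow> measure (P i) (\<Inter>n. ?A n)"
    proof (rule Pi.finite_Lim_measure_decseq)
      show "decseq ?A"
      proof (rule decseq_SucI)
        fix n
        have le: "inverse (real (Suc (Suc n))) \<le> inverse (real (Suc n))"
          by (simp add: field_simps)
        show "?A (Suc n) \<le> ?A n"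
          by (intro Collect_mono impI conj_mono order_trans[OF _ le])
      qed
    qed auto
    moreover have "measure (P i) (\<Inter>n. ?A n) \<le> measure (P i) {\<omega> \<in> space (P i). \<not> 0 < X 1 \<omega>}"
    proof (rule Pi.finite_measure_mono)
      show "(\<Inter>n. ?A n) \<subseteq> {\<omega> \<in> space (P i). \<not> 0 < X 1 \<omega>}"
      proof
        fix \<omega> assume \<omega>: "\<omega> \<in> (\<Inter>n. ?A n)"
        then have *: "\<omega> \<in> ?A n" for n
          by blast
        have "\<not> 0 < X 1 \<omega>"
        proof
          assume "0 < X 1 \<omega>"
          then obtain n where "inverse (real (Suc n)) < X 1 \<omega>"
            using reals_Archimedean by blast
          with *[of n] show False
            by simp
        qed
        with *[of 0] show "\<omega> \<in> {\<omega> \<in> space (P i). \<not> 0 < X 1 \<omega>}"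
          by simp
      qed
    qed auto
    moreover have "measure (P i) {\<omega> \<in> space (P i). \<not> 0 < X 1 \<omega>} = 0"
      using AE_X_pos_from[OF i B] by (subst Pi.prob_Collect_eq_0) auto
    ultimately have "(\<lambda>n. measure (P i) (?A n)) \<longlonglongrightarrow> 0"
      by (simp only: measure_le_0_iff)
    then show ?thesis
      by (rule order_tendstoD) simp
  qed
  then have "eventually (\<lambda>n. \<forall>i\<in>{0..m}. measure (P i)
      {\<omega> \<in> space (P i). X 1 \<omega> \<le> inverse (real (Suc n))} < 1 / 2) sequentially"
    by (intro eventually_ball_finite) auto
  then obtain n where "\<forall>i\<in>{0..m}. measure (P i)
      {\<omega> \<in> space (P i). X 1 \<omega> \<le> inverse (real (Suc n))} < 1 / 2"
    using eventually_happens' sequentially_bot by blast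
  then show ?thesis
    by (intro exI[of _ "inverse (real (Suc n))"]) (auto intro: less_imp_le)
qed

lemma AE_renewal_time_unbounded:
  assumes B: "\<forall>i\<in>{0..m}. \<forall>j\<in>{0..m}. Q i j 0 = 0"
  shows "AE \<omega> in M. \<forall>t. \<exists>n. t < renewal_time X n \<omega>"
proof -
  obtain \<epsilon> where \<epsilon>: "\<epsilon> > 0"
    "\<And>i. i \<in> {0..m} \<Longrightarrow> measure (P i) {\<omega> \<in> space (P i). X 1 \<omega> \<le> \<epsilon>} \<le> 1 / 2"
    using ex_small_jump[OF B] by blast
  \<comment> \<open>With \<open>G = UNIV\<close> the states are unrestricted: what is left almost
    surely is a run of short jumps only.\<close>
  have "AE \<omega> in M. \<not> (J n \<omega> \<in> UNIV \<and> (\<forall>s>n. J s \<omega> \<in> UNIV \<and> X s \<omega> \<in> {..\<epsilon>}))" for n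
    by (rule AE_leave[where c = "1 / 2"]) (use \<epsilon> in auto)
  then have "AE \<omega> in M. \<forall>n. \<exists>s>n. \<epsilon> < X s \<omega>"
    by (simp add: AE_all_countable not_le)
  then show ?thesis
    using AE_space
  proof eventually_elim
    case (elim \<omega>)
    show ?case
      by (intro allI renewal_time_unbounded[where \<epsilon> = \<epsilon>]) (use elim \<epsilon> X_nonneg in auto)
  qed
qed

lemma AE_visits:
  assumes k: "k \<in> {0..m}" and less: "measure (P k) {\<omega> \<in> space (P k). J 1 \<omega> = k} < 1"
  shows "AE \<omega> in M. \<forall>n. \<exists>s>n. J s \<omega> \<in> {0..m} - {k}"
proof -
  \<comment> \<open>\<open>AE_leave\<close> needs the chain to be in \<open>k\<close> at the
    starting time. A path equal to \<open>k\<close> at all times after \<open>n\<close> is in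
    \<open>k\<close> at \<open>Suc n\<close>, wherever it was at time \<open>n\<close>.\<close>
  have "AE \<omega> in M. \<not> (J (Suc n) \<omega> \<in> {k} \<and> (\<forall>s>Suc n. J s \<omega> \<in> {k} \<and> X s \<omega> \<in> UNIV))" for n
    by (rule AE_leave[where c = "measure (P k) {\<omega> \<in> space (P k). J 1 \<omega> = k}"])
      (use less in auto)
  then have "AE \<omega> in M. \<forall>n. \<not> (J (Suc n) \<omega> \<in> {k} \<and> (\<forall>s>Suc n. J s \<omega> \<in> {k} \<and> X s \<omega> \<in> UNIV))"
    by (simp add: AE_all_countable)
  then show ?thesis
    using AE_space
  proof eventually_elim
    case (elim \<omega>)
    have "\<exists>s>n. J s \<omega> \<noteq> k" for n
      using elim(1) by (metis Suc_lessD UNIV_I lessI singletonI singletonD singleton_iff)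
    then show ?case
      using J_le[OF elim(2)] by auto
  qed
qed

text \<open>The steps up to \<open>r - 1\<close>, the jump \<open>r\<close> itself, and the steps
  after \<open>r\<close> are estimated separately. The jump contributes the moment bound
  \<open>C\<close>; each other step from \<open>k\<close> to \<open>k\<close> contributes a factor
  \<open>c\<close>. The first step yields no factor, since the initial state is arbitrary.\<close>

lemma nn_integral_excursion_le:
  fixes c :: real and C :: ennreal
  assumes k: "measure (P k) {\<omega> \<in> space (P k). J 1 \<omega> = k} \<le> c" and c01: "0 \<le> c" "c \<le> 1"
    and C: "\<And>i. i \<in> {0..m} \<Longrightarrow> (\<integral>\<^sup>+\<omega>. ennreal (X 1 \<omega> ^ d) \<partial>P i) \<le> C"
    and r: "1 \<le> r" "r \<le> n"
  shows "(\<integral>\<^sup>+\<omega>. ennreal (X r \<omega> ^ d) * indicator {\<omega>. \<forall>s\<in>{1..n - 1}. J s \<omega> = k} \<omega> \<partial>M)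
    \<le> C * ennreal c ^ (n - 3)"
proof -
  let ?D = "\<lambda>n. indicator {\<omega>. \<forall>s\<in>{1..n}. J s \<omega> = k} :: 'w \<Rightarrow> ennreal"
  have D: "?D n \<in> borel_measurable (history M m J X n)" for n
    using history_indicator[of "{1..n}" n UNIV "{k}"] by simp
  have ck: "emeasure (P i) {\<omega> \<in> space (P i). J 1 \<omega> \<in> {k} \<and> X 1 \<omega> \<in> UNIV} \<le> ennreal c"
    if "i \<in> {k}" "i \<in> {0..m}" for i
  proof -
    interpret Pi: markov_renewal_process "P i" m "\<lambda>j. if j = i then 1 else 0" Q J X
      by (rule process_from[OF that(2)])
    show ?thesis
      unfolding Pi.emeasure_eq_measure using k that by (simp add: ennreal_leI)
  qed
  \<comment> \<open>For \<open>q \<ge> 1\<close> the factor \<open>?D q\<close> forces the chain to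
    be in \<open>k\<close> at time \<open>q\<close>, which is the support condition of
    \<open>nn_integral_stay_le\<close>.\<close>
  have stay: "(\<integral>\<^sup>+\<omega>. h \<omega> * ?D (q + l) \<omega> \<partial>M) \<le> ennreal c ^ l * (\<integral>\<^sup>+\<omega>. h \<omega> * ?D q \<omega> \<partial>M)"
    if h: "h \<in> borel_measurable (history M m J X q)" and q: "1 \<le> q" for h q l
  proof -
    have *: "?D (q + l) \<omega> = ?D q \<omega> * indicator {\<omega>. \<forall>s\<in>{q<..q + l}. J s \<omega> \<in> {k} \<and> X s \<omega> \<in> UNIV} \<omega>" for \<omega>
    proof -
      have "{1..q + l} = {1..q} \<union> {q<..q + l}"
        using q by auto
      then show ?thesis
        by (auto simp: indicator_def)
    qed
    show ?thesis
      unfolding * mult.assoc[symmetric]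
    proof (rule nn_integral_stay_le)
      show "(\<lambda>\<omega>. h \<omega> * ?D q \<omega>) \<in> borel_measurable (history M m J X q)"
        by (intro borel_measurable_times_ennreal h D)
    qed (use q ck in \<open>auto simp: indicator_def split: if_splits\<close>)
  qed
  have le1: "(\<integral>\<^sup>+\<omega>. ?D n \<omega> \<partial>M) \<le> 1" for n
  proof -
    have "(\<integral>\<^sup>+\<omega>. ?D n \<omega> \<partial>M) \<le> (\<integral>\<^sup>+\<omega>. 1 \<partial>M)"
      by (rule nn_integral_mono) (auto simp: indicator_def)
    then show ?thesis
      by (simp add: emeasure_space_1)
  qed
  have a: "(\<integral>\<^sup>+\<omega>. ?D n \<omega> \<partial>M) \<le> ennreal c ^ (n - 1)" for n
  proof (cases "n = 0")
    case True
    then show ?thesis using le1[of 0] by simp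
  next
    case False
    then have "(\<integral>\<^sup>+\<omega>. ?D n \<omega> \<partial>M) \<le> ennreal c ^ (n - 1) * (\<integral>\<^sup>+\<omega>. ?D 1 \<omega> \<partial>M)"
      using stay[of "\<lambda>_. 1" 1 "n - 1"] by simp
    also have "\<dots> \<le> ennreal c ^ (n - 1) * 1"
      by (intro mult_left_mono le1) simp
    finally show ?thesis by simp
  qed
  let ?Y = "\<lambda>\<omega>. ennreal (X r \<omega> ^ d)"
  have Y: "?Y \<in> borel_measurable (history M m J X r)"
    by (intro measurable_compose[OF borel_measurable_power[OF X_history]]) auto
  have b: "(\<integral>\<^sup>+\<omega>. ?Y \<omega> * ?D (r - 1) \<omega> \<partial>M) \<le> C * ennreal c ^ (r - 2)"
  proof -
    have "(\<integral>\<^sup>+\<omega>. ?D (r - 1) \<omega> * ennreal (X (Suc (r - 1)) \<omega> ^ d) \<partial>M) \<le> C * (\<integral>\<^sup>+\<omega>. ?D (r - 1) \<omega> \<partial>M)"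
      by (rule nn_integral_step_le[where g = "\<lambda>_ x. ennreal (x ^ d)", OF D])
        (auto simp: kernel_def J_le intro!: C[simplified])
    also have "\<dots> \<le> C * ennreal c ^ (r - 1 - 1)"
      by (intro mult_left_mono a) simp
    finally show ?thesis
      using r by (simp add: mult.commute numeral_2_eq_2)
  qed
  have "(\<integral>\<^sup>+\<omega>. ?Y \<omega> * ?D (n - 1) \<omega> \<partial>M) \<le> C * ennreal c ^ (n - 1 - r + (r - 2))"
  proof (cases "r = n")
    case True
    then show ?thesis using b by simp
  next
    case False
    then have "(\<integral>\<^sup>+\<omega>. ?Y \<omega> * ?D (n - 1) \<omega> \<partial>M) \<le> ennreal c ^ (n - 1 - r) * (\<integral>\<^sup>+\<omega>. ?Y \<omega> * ?D r \<omega> \<partial>M)"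
      using stay[OF Y, of "n - 1 - r"] r by simp
    \<comment> \<open>The condition on \<open>J r\<close> is dropped, because \<open>J r\<close> and
      \<open>X r\<close> arise in the same step and only the moment of \<open>X r\<close> is
      bounded.\<close>
    also have "\<dots> \<le> ennreal c ^ (n - 1 - r) * (\<integral>\<^sup>+\<omega>. ?Y \<omega> * ?D (r - 1) \<omega> \<partial>M)"
      by (intro mult_left_mono nn_integral_mono) (auto simp: indicator_def)
    also have "\<dots> \<le> ennreal c ^ (n - 1 - r) * (C * ennreal c ^ (r - 2))"
      by (intro mult_left_mono b) simp
    finally show ?thesis
      by (simp add: power_add ac_simps)
  qed
  \<comment> \<open>The exponent equals \<open>n - 3\<close> for
    \<open>2 \<le> r \<le> n - 1\<close>. At \<open>r = 1\<close> and \<open>r = n\<close> truncated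
    subtraction makes it at least that, and \<open>c \<le> 1\<close> gives a common bound.\<close>
  also have "\<dots> \<le> C * ennreal c ^ (n - 3)"
    using c01 by (intro mult_left_mono power_decreasing) auto
  finally show ?thesis .
qed

end

section \<open>A power of a finite sum and a convergent series\<close>

lemma sum_power_le:
  fixes x :: "'b \<Rightarrow> real"
  assumes "finite A" "A \<noteq> {}" and nonneg: "\<And>r. r \<in> A \<Longrightarrow> 0 \<le> x r"
  shows "(\<Sum>r\<in>A. x r) ^ d \<le> real (card A) ^ d * (\<Sum>r\<in>A. x r ^ d)"
proof -
  \<comment> \<open>The largest term: the sum is at most \<open>card A\<close> times it, and its
    power is one of the summands on the right.\<close>
  obtain a where a: "a \<in> A" "x a = Max (x ` A)"
    using assms(1,2) Max_in[of "x ` A"] by fastforce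
  have "(\<Sum>r\<in>A. x r) \<le> real (card A) * x a"
    using assms a by (intro sum_bounded_above) auto
  then have "(\<Sum>r\<in>A. x r) ^ d \<le> (real (card A) * x a) ^ d"
    by (intro power_mono sum_nonneg nonneg)
  also have "\<dots> = real (card A) ^ d * x a ^ d"
    by (rule power_mult_distrib)
  also have "\<dots> \<le> real (card A) ^ d * (\<Sum>r\<in>A. x r ^ d)"
    using assms a by (intro mult_left_mono member_le_sum) auto
  finally show ?thesis .
qed

lemma summable_power_times_geometric:
  fixes c :: real
  assumes "0 \<le> c" "c < 1"
  shows "summable (\<lambda>n. real n ^ d * c ^ (n - l))"
proof -
  obtain c' where c': "c < c'" "c' < 1"
    using dense assms(2) by blast
  have "(\<lambda>n. (real (Suc n) / real n) ^ d * c) \<longlonglongrightarrow> 1 ^ d * c"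
    by (intro tendsto_mult tendsto_power LIMSEQ_Suc_n_over_n tendsto_const)
  then have "\<forall>\<^sub>F n in sequentially. (real (Suc n) / real n) ^ d * c < c'"
    by (rule order_tendstoD) (use c' in simp)
  then obtain N where N: "\<And>n. n \<ge> N \<Longrightarrow> (real (Suc n) / real n) ^ d * c < c'"
    by (auto simp: eventually_sequentially)
  show ?thesis
  \<comment> \<open>Starting beyond \<open>l\<close> keeps \<open>n\<close> nonzero in the quotient
    and makes \<open>Suc n - l\<close> the successor of \<open>n - l\<close>.\<close>
  proof (rule summable_ratio_test[OF c'(2), of "max N (Suc l)"])
    fix n assume n: "max N (Suc l) \<le> n"
    then have "real (Suc n) ^ d * c = real n ^ d * ((real (Suc n) / real n) ^ d * c)"
      by (simp add: power_divide)
    also have "\<dots> \<le> real n ^ d * c'"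
      using N[of n] n by (intro mult_left_mono) auto
    finally have "real (Suc n) ^ d * c * c ^ (n - l) \<le> real n ^ d * c' * c ^ (n - l)"
      using assms by (intro mult_right_mono) auto
    moreover have "Suc n - l = Suc (n - l)"
      using n by (simp add: Suc_diff_le)
    ultimately show "norm (real (Suc n) ^ d * c ^ (Suc n - l)) \<le> c' * norm (real n ^ d * c ^ (n - l))"
      using assms by (simp add: abs_mult ac_simps)
  qed
qed

section \<open>Communicating classes\<close>

lemma step_prob_nonneg:
  assumes "\<And>i j. i \<in> S \<Longrightarrow> j \<in> S \<Longrightarrow> 0 \<le> q i j" "i \<in> S"
  shows "0 \<le> step_prob S q n i j"
  using assms(2) by (induction n arbitrary: i) (auto intro!: sum_nonneg mult_nonneg_nonneg assms(1))

text \<open>A sum of nonnegative products is positive exactly if one product is, so positive step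
  probabilities are paths in the graph of positive entries. The condition \<open>n \<ge> 1\<close>
  corresponds to the transitive, not the reflexive transitive, closure.\<close>

lemma ex_step_prob_pos_iff:
  assumes "finite S" and q: "\<And>i j. i \<in> S \<Longrightarrow> j \<in> S \<Longrightarrow> 0 \<le> q i j" and ij: "i \<in> S" "j \<in> S"
  shows "(\<exists>n\<ge>1. step_prob S q n i j > 0) \<longleftrightarrow> (i, j) \<in> {(a, b). a \<in> S \<and> b \<in> S \<and> 0 < q a b}\<^sup>+"
    (is "_ \<longleftrightarrow> _ \<in> ?E\<^sup>+")
proof
  have "(i, j) \<in> ?E\<^sup>+" if "step_prob S q (Suc n) i j > 0" "i \<in> S" for n i
    using that
  proof (induction n arbitrary: i)
    case 0
    then have "q i j > 0"
      using \<open>finite S\<close> ij(2) by (simp add: if_distrib[of "(*) _"] sum.delta cong: if_cong)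
    then show ?case
      using 0 ij(2) by auto
  next
    case (Suc n)
    have "(\<Sum>l\<in>S. q i l * step_prob S q (Suc n) l j) > 0"
      using Suc.prems(1) by (subst (asm) step_prob.simps(2))
    then obtain l where l: "l \<in> S" "0 < q i l * step_prob S q (Suc n) l j"
      using sum_nonpos[of S "\<lambda>l. q i l * step_prob S q (Suc n) l j"] by (meson not_less)
    have "0 \<le> q i l" "0 \<le> step_prob S q (Suc n) l j"
      using q Suc.prems(2) l(1) step_prob_nonneg[of S q l "Suc n"] by blast+
    with l(2) have "0 < q i l" "0 < step_prob S q (Suc n) l j"
      by (simp_all add: zero_less_mult_iff)
    then show ?case
      using Suc.IH[of l] Suc.prems l by (auto intro: trancl_into_trancl2)
  qed
  moreover assume "\<exists>n\<ge>1. step_prob S q n i j > 0"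
  then obtain n where "step_prob S q (Suc n) i j > 0"
    by (metis One_nat_def Suc_le_D)
  ultimately show "(i, j) \<in> ?E\<^sup>+"
    using ij by blast
next
  have pos: "0 < step_prob S q (Suc n) a j" if "0 < q a l" "0 < step_prob S q n l j" "a \<in> S" "l \<in> S" for a l n
    unfolding step_prob.simps using that \<open>finite S\<close>
    by (intro sum_pos2[of S l]) (auto intro!: mult_nonneg_nonneg q step_prob_nonneg)
  assume "(i, j) \<in> ?E\<^sup>+"
  then show "\<exists>n\<ge>1. step_prob S q n i j > 0"
  proof (induction rule: converse_trancl_induct)
    case (base y)
    then show ?case
      using pos[of y j 0] by (intro exI[of _ 1]) auto
  next
    case (step y z)
    then obtain n where "step_prob S q n z j > 0" by blast
    then show ?case
      using pos[of y z n] step by (intro exI[of _ "Suc n"]) auto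
  qed
qed

lemma communicative_iff:
  assumes "finite S" "\<And>i j. i \<in> S \<Longrightarrow> j \<in> S \<Longrightarrow> 0 \<le> q i j"
  shows "communicative S q \<longleftrightarrow> (\<forall>i\<in>S. \<forall>j\<in>S. (i, j) \<in> {(a, b). a \<in> S \<and> b \<in> S \<and> 0 < q a b}\<^sup>+)"
  unfolding communicative_def using assms by (simp add: ex_step_prob_pos_iff del: One_nat_def)

text \<open>A path through \<open>k\<close> is cut down to its last state \<open>s\<close> before \<open>k\<close>; loops at \<open>k\<close> are dropped.\<close>

lemma communicative_exclude:
  assumes "finite S" and p: "\<And>i j. i \<in> S \<Longrightarrow> j \<in> S \<Longrightarrow> 0 \<le> p i j"
    and q: "\<And>i j. i \<in> S - {k} \<Longrightarrow> j \<in> S - {k} \<Longrightarrow> 0 \<le> q i j"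
    and direct: "\<And>i j. i \<in> S - {k} \<Longrightarrow> j \<in> S - {k} \<Longrightarrow> 0 < p i j \<Longrightarrow> 0 < q i j"
    and via: "\<And>i j. i \<in> S - {k} \<Longrightarrow> j \<in> S - {k} \<Longrightarrow> 0 < p i k \<Longrightarrow> 0 < p k j \<Longrightarrow> 0 < q i j"
    and comm: "communicative S p"
  shows "communicative (S - {k}) q"
proof -
  let ?E = "{(a, b). a \<in> S \<and> b \<in> S \<and> 0 < p a b}"
  let ?E' = "{(a, b). a \<in> S - {k} \<and> b \<in> S - {k} \<and> 0 < q a b}"
  \<comment> \<open>While the path sits at \<open>k\<close>, the induction remembers the state
    \<open>s\<close> from which \<open>k\<close> was entered. The closure leading to
    \<open>s\<close> is reflexive because \<open>s\<close> may be \<open>i\<close>.\<close>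
  have *: "(l \<noteq> k \<longrightarrow> (i, l) \<in> ?E'\<^sup>+) \<and> (l = k \<longrightarrow> (\<exists>s\<in>S - {k}. (i, s) \<in> ?E'\<^sup>* \<and> 0 < p s k))"
    if "(i, l) \<in> ?E\<^sup>+" "i \<in> S - {k}" for i l
    using that
  proof (induction rule: trancl_induct)
    case (base y)
    then show ?case
      using direct[of i y] by (cases "y = k") auto
  next
    case (step y z)
    show ?case
    proof (cases "y = k")
      case True
      then obtain s where s: "s \<in> S - {k}" "(i, s) \<in> ?E'\<^sup>*" "0 < p s k"
        using step by auto
      show ?thesis
      proof (cases "z = k")
        case False
        then have "(s, z) \<in> ?E'"
          using via[of s z] s step True by auto
        then show ?thesis
          using s False by (auto intro: rtrancl_into_trancl1)
      qed (use s in auto)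
    next
      case y: False
      then have "(i, y) \<in> ?E'\<^sup>+"
        using step by auto
      then show ?thesis
        using y step direct[of y z] by (cases "z = k") (auto intro: trancl_into_trancl)
    qed
  qed
  show ?thesis
    using comm * \<open>finite S\<close> p q by (subst communicative_iff) (auto simp: communicative_iff[OF \<open>finite S\<close> p])
qed

text \<open>On a path from \<open>k\<close> to \<open>j \<noteq> k\<close>, the first edge ending
  outside \<open>k\<close> starts at \<open>k\<close>.\<close>

lemma communicative_exit:
  assumes "finite S" "\<And>i j. i \<in> S \<Longrightarrow> j \<in> S \<Longrightarrow> 0 \<le> p i j"
    and "communicative S p" "k \<in> S" "j \<in> S" "j \<noteq> k"
  shows "\<exists>s\<in>S - {k}. 0 < p k s"
proof -
  let ?E = "{(a, b). a \<in> S \<and> b \<in> S \<and> 0 < p a b}"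
  have "(k, j) \<in> ?E\<^sup>+"
    using assms by (auto simp: communicative_iff)
  then have "j \<noteq> k \<longrightarrow> (\<exists>s\<in>S - {k}. 0 < p k s)"
    by (induction rule: trancl_induct) auto
  then show ?thesis
    using assms by simp
qed

section \<open>Hitting times\<close>

text \<open>The renewal times increase strictly and without bound, so the count at the
  \<open>n\<close>-th of them is \<open>n\<close>; and at any \<open>t\<close> the last renewal time
  not exceeding \<open>t\<close> shows the same state as \<open>t\<close>. Each infimum therefore
  bounds the other, also when state 0 is never hit and both are infinite.\<close>

lemma hitting_time_eq:
  assumes pos: "\<And>n. 1 \<le> n \<Longrightarrow> 0 < X n \<omega>" and unbounded: "\<And>t. \<exists>n. t < renewal_time X n \<omega>"
  shows "hitting_time J X \<omega> = (INF n\<in>{n. 1 \<le> n \<and> J n \<omega> = 0}. ennreal (renewal_time X n \<omega>))"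
proof -
  let ?T = "\<lambda>n. renewal_time X n \<omega>"
  have mono: "strict_mono ?T"
    unfolding strict_mono_Suc_iff by (auto simp: renewal_time_def pos)
  have T1: "?T 1 = X 1 \<omega>"
    by (simp add: renewal_time_def)
  \<comment> \<open>Finiteness gives the \<open>Max\<close> in \<open>renewal_count\<close> its
    intended meaning.\<close>
  have fin: "finite {n. ?T n \<le> t}" for t
  proof -
    obtain N where "t < ?T N"
      using unbounded by blast
    then have "{n. ?T n \<le> t} \<subseteq> {..N}"
      using strict_mono_less_eq[OF mono] by (auto intro: ccontr simp: not_le dest!: less_imp_le) (meson linorder_not_le order_trans)
    then show ?thesis
      by (rule finite_subset) simp
  qed
  show ?thesis
  proof (rule antisym)
    show "hitting_time J X \<omega> \<le> (INF n\<in>{n. 1 \<le> n \<and> J n \<omega> = 0}. ennreal (?T n))"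
    proof (rule INF_greatest)
      fix n assume n: "n \<in> {n. 1 \<le> n \<and> J n \<omega> = 0}"
      have "renewal_count X (?T n) \<omega> = n"
        unfolding renewal_count_def
        by (rule Max_eqI[OF fin]) (auto simp: strict_mono_less_eq[OF mono])
      moreover have "X 1 \<omega> \<le> ?T n"
        using n by (simp add: T1[symmetric] strict_mono_less_eq[OF mono] del: One_nat_def)
      ultimately show "hitting_time J X \<omega> \<le> ennreal (?T n)"
        unfolding hitting_time_def using n by (intro INF_lower) (simp add: semi_markov_def)
    qed
  next
    show "(INF n\<in>{n. 1 \<le> n \<and> J n \<omega> = 0}. ennreal (?T n)) \<le> hitting_time J X \<omega>"
      unfolding hitting_time_def
    proof (rule INF_greatest)
      fix t assume t: "t \<in> {t. X 1 \<omega> \<le> t \<and> semi_markov J X t \<omega> = 0}"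
      let ?n = "renewal_count X t \<omega>"
      \<comment> \<open>Since \<open>t\<close> is at least the first jump, the count is at least 1,
        so an initial state 0 is not taken for a hit.\<close>
      have 1: "1 \<in> {n. ?T n \<le> t}"
        using t T1 by simp
      then have "1 \<le> ?n"
        unfolding renewal_count_def by (intro Max_ge fin)
      moreover have "?n \<in> {n. ?T n \<le> t}"
        unfolding renewal_count_def by (rule Max_in[OF fin]) (use 1 in blast)
      ultimately show "(INF n\<in>{n. 1 \<le> n \<and> J n \<omega> = 0}. ennreal (?T n)) \<le> ennreal t"
        using t by (intro INF_lower2[of ?n]) (auto simp: semi_markov_def intro: ennreal_leI)
    qed
  qed
qed

section \<open>Visit epochs along one path\<close>

lemma reduced_X_1: "reduced_X S J X 1 \<omega> = (\<Sum>r = 1..visit_epoch S J 1 \<omega>. X r \<omega>)"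
  by (simp add: reduced_X_def)

text \<open>These facts are pathwise. The path visits \<open>S\<close> infinitely often, so no
  \<open>LEAST\<close> in \<open>visit_epoch\<close> ranges over an empty set.\<close>

context
  fixes S :: "nat set" and J :: "nat \<Rightarrow> 'w \<Rightarrow> nat" and \<omega> :: 'w
  assumes visits: "\<And>n. \<exists>s>n. J s \<omega> \<in> S"
begin

lemma visit_epoch_Suc:
  "visit_epoch S J n \<omega> < visit_epoch S J (Suc n) \<omega>" "J (visit_epoch S J (Suc n) \<omega>) \<omega> \<in> S"
  using LeastI_ex[OF visits[of "visit_epoch S J n \<omega>"]] by simp_all

lemma visit_epoch_Suc_le:
  "visit_epoch S J n \<omega> < r \<Longrightarrow> J r \<omega> \<in> S \<Longrightarrow> visit_epoch S J (Suc n) \<omega> \<le> r"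
  by (auto intro: Least_le)

lemma strict_mono_visit_epoch: "strict_mono (\<lambda>n. visit_epoch S J n \<omega>)"
  unfolding strict_mono_Suc_iff using visit_epoch_Suc(1) by blast

text \<open>Take the first index whose epoch is at least \<open>r\<close>. The epoch before it is
  smaller than \<open>r\<close>, so minimality of the next visit puts that visit at or before
  \<open>r\<close>.\<close>

lemma visit_epoch_surj:
  assumes "1 \<le> r" "J r \<omega> \<in> S"
  shows "\<exists>n\<ge>1. visit_epoch S J n \<omega> = r"
proof -
  let ?n = "LEAST n. r \<le> visit_epoch S J n \<omega>"
  have "r \<le> visit_epoch S J r \<omega>"
    using strict_mono_imp_increasing[OF strict_mono_visit_epoch] by blast
  then have n: "r \<le> visit_epoch S J ?n \<omega>"
    by (rule LeastI)
  then obtain n' where n': "?n = Suc n'"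
    using assms(1) by (cases ?n) auto
  then have "visit_epoch S J n' \<omega> < r"
    using not_less_Least[of n' "\<lambda>n. r \<le> visit_epoch S J n \<omega>"] by simp
  from visit_epoch_Suc_le[OF this assms(2)] show ?thesis
    using n n' by (intro exI[of _ "Suc n'"]) simp
qed

text \<open>The reduced jumps are sums over consecutive blocks of jumps, and the blocks join up from
  epoch 0.\<close>

lemma renewal_time_reduced:
  "renewal_time (reduced_X S J X) n \<omega> = renewal_time X (visit_epoch S J n \<omega>) \<omega>"
proof (induction n)
  case 0
  show ?case by (simp add: renewal_time_def)
next
  case (Suc n)
  obtain l where l: "visit_epoch S J (Suc n) \<omega> = visit_epoch S J n \<omega> + l"
    using visit_epoch_Suc(1)[of n] less_imp_add_positive by metis
  have "renewal_time (reduced_X S J X) (Suc n) \<omega> =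
      renewal_time X (visit_epoch S J n \<omega>) \<omega> + reduced_X S J X (Suc n) \<omega>"
    using Suc by (simp add: renewal_time_def)
  also have "\<dots> = renewal_time X (visit_epoch S J n \<omega> + l) \<omega>"
    unfolding renewal_time_def reduced_X_def l by (subst sum.ub_add_nat) (simp_all add: l del: visit_epoch.simps)
  finally show ?case
    unfolding l .
qed

lemma reduced_X_pos:
  assumes "\<And>n. 1 \<le> n \<Longrightarrow> 0 < X n \<omega>" "1 \<le> n"
  shows "0 < reduced_X S J X n \<omega>"
proof -
  obtain n' where "n = Suc n'"
    using assms(2) by (cases n) auto
  then show ?thesis
    using visit_epoch_Suc(1)[of n'] unfolding reduced_X_def
    by (auto intro!: sum_pos assms(1) simp del: visit_epoch.simps)
qed

text \<open>As \<open>0 \<in> S\<close>, every epoch \<open>n \<ge> 1\<close> in state 0 is a visit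
  epoch. Both infima given by \<open>hitting_time_eq\<close> are then over the same set of renewal
  times.\<close>

lemma hitting_time_reduced:
  assumes "0 \<in> S" and pos: "\<And>n. 1 \<le> n \<Longrightarrow> 0 < X n \<omega>"
    and unbounded: "\<And>t. \<exists>n. t < renewal_time X n \<omega>"
  shows "hitting_time J X \<omega> = hitting_time (reduced_J S J) (reduced_X S J X) \<omega>"
proof -
  have mono: "mono (\<lambda>n. renewal_time X n \<omega>)"
    unfolding mono_iff_le_Suc using pos by (auto simp: renewal_time_def intro: less_imp_le)
  have unbounded': "\<exists>n. t < renewal_time (reduced_X S J X) n \<omega>" for t
  proof -
    obtain n where "t < renewal_time X n \<omega>"
      using unbounded by blast
    also have "\<dots> \<le> renewal_time X (visit_epoch S J n \<omega>) \<omega>"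
      using strict_mono_imp_increasing[OF strict_mono_visit_epoch] by (rule monoD[OF mono])
    finally show ?thesis
      unfolding renewal_time_reduced by blast
  qed
  have "(\<lambda>n. visit_epoch S J n \<omega>) ` {n. 1 \<le> n \<and> reduced_J S J n \<omega> = 0} = {n. 1 \<le> n \<and> J n \<omega> = 0}"
    (is "?V ` ?A' = ?A")
  proof
    have "1 \<le> ?V n" if "1 \<le> n" for n
      using strict_mono_imp_increasing[OF strict_mono_visit_epoch, of n] that by simp
    then show "?V ` ?A' \<subseteq> ?A"
      by (auto simp: reduced_J_def)
    show "?A \<subseteq> ?V ` ?A'"
      using visit_epoch_surj \<open>0 \<in> S\<close> by (fastforce simp: reduced_J_def)
  qed
  then have "(\<lambda>n. ennreal (renewal_time X n \<omega>)) ` ?A =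
      (\<lambda>n. ennreal (renewal_time (reduced_X S J X) n \<omega>)) ` ?A'"
    unfolding renewal_time_reduced by (subst image_image[symmetric, of _ ?V ?A']) simp
  moreover have "hitting_time J X \<omega> = (INF n\<in>?A. ennreal (renewal_time X n \<omega>))"
    by (rule hitting_time_eq) (fact pos unbounded)+
  moreover have "hitting_time (reduced_J S J) (reduced_X S J X) \<omega> =
      (INF n\<in>?A'. ennreal (renewal_time (reduced_X S J X) n \<omega>))"
    by (rule hitting_time_eq) (use reduced_X_pos[of X] pos unbounded' in auto)
  ultimately show ?thesis
    by simp
qed

end

section \<open>The reduced process\<close>

context markov_renewal_process
begin

lemma visit_epoch_1_measurable [measurable]: "visit_epoch S J 1 \<in> M \<rightarrow>\<^sub>M count_space UNIV"
proof -
  have "(\<lambda>\<omega>. LEAST r. 0 < r \<and> J r \<omega> \<in> S) \<in> M \<rightarrow>\<^sub>M count_space UNIV"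
    by measurable
  then show ?thesis
    by (simp add: fun_eq_iff[of "visit_epoch S J 1"] cong: measurable_cong)
qed

lemma reduced_J_1_measurable [measurable]: "reduced_J S J 1 \<in> M \<rightarrow>\<^sub>M count_space UNIV"
proof -
  have "(\<lambda>\<omega>. J (visit_epoch S J 1 \<omega>) \<omega>) \<in> M \<rightarrow>\<^sub>M count_space UNIV"
    by (rule measurable_compose_countable[OF J_count_space visit_epoch_1_measurable])
  then show ?thesis
    by (simp add: reduced_J_def[abs_def])
qed

lemma reduced_X_1_measurable [measurable]: "reduced_X S J X 1 \<in> borel_measurable M"
proof -
  have "(\<lambda>\<omega>. \<Sum>r = 1..visit_epoch S J 1 \<omega>. X r \<omega>) \<in> borel_measurable M"
    by (rule measurable_compose_countable[OF _ visit_epoch_1_measurable]) measurable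
  then show ?thesis
    unfolding reduced_X_1[symmetric] .
qed

end

section \<open>Transition probabilities and moments of the reduced process\<close>

context markov_renewal_family
begin

lemma embedded_reduced_eq:
  assumes i: "i \<in> {0..m}"
  shows "embedded (reduced_Q S P J X) i j = measure (P i) {\<omega> \<in> space (P i). reduced_J S J 1 \<omega> = j}"
proof -
  interpret Pi: markov_renewal_process "P i" m "\<lambda>j. if j = i then 1 else 0" Q J X
    by (rule process_from[OF i])
  have "(reduced_Q S P J X i j \<longlongrightarrow> measure (P i) {\<omega> \<in> space (P i). reduced_J S J 1 \<omega> = j}) at_top"
    unfolding reduced_Q_def by (rule Pi.tendsto_measure_and_le_at_top) measurable
  then show ?thesis
    unfolding embedded_def by (intro tendsto_Lim) auto
qed

text \<open>The Markov property at time 1, with the indicator of \<open>J 1 \<omega> = k\<close> as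
  weight.\<close>

lemma measure_two_steps:
  assumes k: "k \<in> {0..m}"
  shows "measure M {\<omega> \<in> space M. J 1 \<omega> = k \<and> J 2 \<omega> = j} =
    measure M {\<omega> \<in> space M. J 1 \<omega> = k} * measure (P k) {\<omega> \<in> space (P k). J 1 \<omega> = j}"
proof -
  interpret Pk: markov_renewal_process "P k" m "\<lambda>j. if j = k then 1 else 0" Q J X
    by (rule process_from[OF k])
  let ?h = "indicator {\<omega>. \<forall>s\<in>{1}. J s \<omega> \<in> {k} \<and> X s \<omega> \<in> UNIV} :: 'w \<Rightarrow> ennreal"
  let ?g = "\<lambda>l (x :: real). indicator {j} l :: ennreal"
  have h: "?h \<in> borel_measurable (history M m J X 1)"
    by (rule history_indicator) auto
  have K: "kernel ?g k = emeasure (P k) {\<omega> \<in> space (P k). J 1 \<omega> = j}"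
  proof -
    have "kernel ?g k = (\<integral>\<^sup>+\<omega>. indicator {\<omega> \<in> space (P k). J 1 \<omega> = j} \<omega> \<partial>P k)"
      unfolding kernel_def by (rule nn_integral_cong) (auto simp: indicator_def)
    then show ?thesis
      by simp
  qed
  have "emeasure M {\<omega> \<in> space M. J 1 \<omega> = k \<and> J 2 \<omega> = j} =
      (\<integral>\<^sup>+\<omega>. indicator {\<omega> \<in> space M. J 1 \<omega> = k \<and> J 2 \<omega> = j} \<omega> \<partial>M)"
    by (rule nn_integral_indicator[symmetric]) measurable
  also have "\<dots> = (\<integral>\<^sup>+\<omega>. ?h \<omega> * ?g (J (Suc 1) \<omega>) (X (Suc 1) \<omega>) \<partial>M)"
    by (rule nn_integral_cong) (auto simp: indicator_def numeral_2_eq_2)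
  also have "\<dots> = (\<integral>\<^sup>+\<omega>. ?h \<omega> * kernel ?g (J 1 \<omega>) \<partial>M)"
    by (rule nn_integral_step[OF h]) simp
  also have "\<dots> = (\<integral>\<^sup>+\<omega>. kernel ?g k * indicator {\<omega> \<in> space M. J 1 \<omega> = k} \<omega> \<partial>M)"
    by (rule nn_integral_cong) (auto simp: indicator_def)
  also have "\<dots> = kernel ?g k * emeasure M {\<omega> \<in> space M. J 1 \<omega> = k}"
    by (rule nn_integral_cmult_indicator) measurable
  finally show ?thesis
    unfolding K emeasure_eq_measure Pk.emeasure_eq_measure
    by (simp add: ennreal_mult[symmetric] mult.commute del: One_nat_def)
qed

text \<open>If \<open>J 1 \<omega>\<close> lies in \<open>S\<close>, the first visit is at epoch 1,
  whatever the path does later. Under \<open>P i\<close> this bounds the reduced transition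
  probability below by the direct one.\<close>

lemma measure_J_1_le_reduced:
  assumes "j \<in> S"
  shows "measure M {\<omega> \<in> space M. J 1 \<omega> = j} \<le> measure M {\<omega> \<in> space M. reduced_J S J 1 \<omega> = j}"
proof (rule finite_measure_mono)
  have "reduced_J S J 1 \<omega> = j" if "J 1 \<omega> = j" for \<omega>
  proof -
    have "(LEAST r. 0 < r \<and> J r \<omega> \<in> S) = 1"
      by (rule Least_equality) (use assms that in auto)
    then show ?thesis
      using that by (simp add: reduced_J_def)
  qed
  then show "{\<omega> \<in> space M. J 1 \<omega> = j} \<subseteq> {\<omega> \<in> space M. reduced_J S J 1 \<omega> = j}"
    by blast
qed measurable

text \<open>A path that is in \<open>k\<close> at time 1 and in \<open>S\<close> at time 2 has its
  first visit at epoch 2. With \<open>measure_two_steps\<close> this gives the transitions that pass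
  through \<open>k\<close> once.\<close>

lemma measure_J_2_le_reduced:
  assumes "j \<in> S" "k \<notin> S"
  shows "measure M {\<omega> \<in> space M. J 1 \<omega> = k \<and> J 2 \<omega> = j} \<le> measure M {\<omega> \<in> space M. reduced_J S J 1 \<omega> = j}"
proof (rule finite_measure_mono)
  have "reduced_J S J 1 \<omega> = j" if "J 1 \<omega> = k" "J 2 \<omega> = j" for \<omega>
  proof -
    have "(LEAST r. 0 < r \<and> J r \<omega> \<in> S) = 2"
    proof (rule Least_equality)
      fix r assume "0 < r \<and> J r \<omega> \<in> S"
      then have "r \<noteq> 0" "r \<noteq> 1"
        using that assms by auto
      then show "2 \<le> r"
        by simp
    qed (use assms that in auto)
    then show ?thesis
      using that by (simp add: reduced_J_def)
  qed
  then show "{\<omega> \<in> space M. J 1 \<omega> = k \<and> J 2 \<omega> = j} \<subseteq> {\<omega> \<in> space M. reduced_J S J 1 \<omega> = j}"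
    by blast
qed measurable

text \<open>State 0 differs from \<open>k\<close> and is reachable from it, so some transition out
  of \<open>k\<close> has positive probability and takes its mass from the event of staying.\<close>

lemma measure_stay_less_1:
  assumes A: "communicative {0..m} (embedded Q)" and k: "k \<in> {0..m}" "k \<noteq> 0"
  shows "measure (P k) {\<omega> \<in> space (P k). J 1 \<omega> = k} < 1"
proof -
  interpret Pk: markov_renewal_process "P k" m "\<lambda>j. if j = k then 1 else 0" Q J X
    by (rule process_from[OF k(1)])
  have "\<exists>s\<in>{0..m} - {k}. 0 < embedded Q k s"
    by (rule communicative_exit[OF _ _ A k(1), of 0]) (use k in \<open>auto simp: embedded_eq\<close>)
  then obtain s where s: "s \<in> {0..m} - {k}" "0 < embedded Q k s"
    by blast
  have "measure (P k) {\<omega> \<in> space (P k). J 1 \<omega> = k} + measure (P k) {\<omega> \<in> space (P k). J 1 \<omega> = s} =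
      measure (P k) ({\<omega> \<in> space (P k). J 1 \<omega> = k} \<union> {\<omega> \<in> space (P k). J 1 \<omega> = s})"
    by (rule Pk.finite_measure_Union[symmetric]) (use s in auto)
  also have "\<dots> \<le> 1"
    by (rule Pk.prob_le_1)
  finally show ?thesis
    using s k by (simp add: embedded_eq)
qed

lemma communicative_reduced:
  assumes A: "communicative {0..m} (embedded Q)" and k: "k \<in> {0..m}"
  shows "communicative ({0..m} - {k}) (embedded (reduced_Q ({0..m} - {k}) P J X))"
proof (rule communicative_exclude[OF _ _ _ _ _ A])
  fix i j assume i: "i \<in> {0..m} - {k}" and j: "j \<in> {0..m} - {k}"
  interpret Pi: markov_renewal_family "P i" m "\<lambda>j. if j = i then 1 else 0" Q J X P
    by (rule family_from) (use i in simp)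
  show "0 \<le> embedded (reduced_Q ({0..m} - {k}) P J X) i j"
    using i by (simp add: embedded_reduced_eq)
  show "0 < embedded (reduced_Q ({0..m} - {k}) P J X) i j" if "0 < embedded Q i j"
    using i j that Pi.measure_J_1_le_reduced[of j "{0..m} - {k}"]
    by (simp add: embedded_reduced_eq embedded_eq del: One_nat_def)
  show "0 < embedded (reduced_Q ({0..m} - {k}) P J X) i j" if "0 < embedded Q i k" "0 < embedded Q k j"
  proof -
    have "0 < measure (P i) {\<omega> \<in> space (P i). J 1 \<omega> = k \<and> J 2 \<omega> = j}"
      unfolding Pi.measure_two_steps[OF k] using that i j k by (simp add: embedded_eq)
    then show ?thesis
      using i j Pi.measure_J_2_le_reduced[of j "{0..m} - {k}" k]
      by (simp add: embedded_reduced_eq del: One_nat_def)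
  qed
qed (use k in \<open>auto simp: embedded_eq\<close>)

text \<open>A reduced jump is almost surely a nonempty sum of positive jumps.\<close>

lemma reduced_Q_0:
  assumes A: "communicative {0..m} (embedded Q)"
    and B: "\<forall>i\<in>{0..m}. \<forall>j\<in>{0..m}. Q i j 0 = 0"
    and k: "k \<in> {0..m}" "k \<noteq> 0" and i: "i \<in> {0..m}"
  shows "reduced_Q ({0..m} - {k}) P J X i j 0 = 0"
proof -
  interpret Pi: markov_renewal_family "P i" m "\<lambda>j. if j = i then 1 else 0" Q J X P
    by (rule family_from[OF i])
  let ?S = "{0..m} - {k}"
  have "AE \<omega> in P i. \<not> (reduced_J ?S J 1 \<omega> = j \<and> reduced_X ?S J X 1 \<omega> \<le> 0)"
    using Pi.AE_X_pos[OF B] Pi.AE_visits[OF k(1) measure_stay_less_1[OF A k]]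
  proof eventually_elim
    case (elim \<omega>)
    have "0 < reduced_X ?S J X 1 \<omega>"
      by (rule reduced_X_pos) (use elim in auto)
    then show ?case
      by simp
  qed
  then show ?thesis
    unfolding reduced_Q_def by (subst Pi.prob_Collect_eq_0) measurable
qed

lemma AE_hitting_time_reduced:
  assumes A: "communicative {0..m} (embedded Q)"
    and B: "\<forall>i\<in>{0..m}. \<forall>j\<in>{0..m}. Q i j 0 = 0"
    and k: "k \<in> {0..m}" "k \<noteq> 0"
  shows "AE \<omega> in M. hitting_time J X \<omega> =
    hitting_time (reduced_J ({0..m} - {k}) J) (reduced_X ({0..m} - {k}) J X) \<omega>"
  using AE_X_pos[OF B] AE_visits[OF k(1) measure_stay_less_1[OF A k]] AE_renewal_time_unbounded[OF B]
  by eventually_elim (rule hitting_time_reduced, use k in auto)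

text \<open>The first visit is at epoch \<open>n\<close> only after \<open>n - 1\<close> states
  equal to \<open>k\<close>. On that event \<open>sum_power_le\<close> separates the jumps, and
  \<open>nn_integral_excursion_le\<close> bounds each of them by a term decaying geometrically in
  \<open>n\<close>.\<close>

lemma nn_integral_reduced_X_power_finite:
  assumes k: "k \<in> {0..m}" and less: "measure (P k) {\<omega> \<in> space (P k). J 1 \<omega> = k} < 1"
    and C: "\<And>i. i \<in> {0..m} \<Longrightarrow> (\<integral>\<^sup>+\<omega>. ennreal (X 1 \<omega> ^ d) \<partial>P i) \<le> ennreal C" "0 \<le> C"
  shows "(\<integral>\<^sup>+\<omega>. ennreal (reduced_X ({0..m} - {k}) J X 1 \<omega> ^ d) \<partial>M) < \<infinity>"
proof -
  let ?S = "{0..m} - {k}"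
  define c where "c = measure (P k) {\<omega> \<in> space (P k). J 1 \<omega> = k}"
  have c: "0 \<le> c" "c < 1"
    using less by (simp_all add: c_def)
  let ?I = "\<lambda>n. indicator {\<omega>. \<forall>s\<in>{1..n - 1}. J s \<omega> = k} :: 'w \<Rightarrow> ennreal"
  \<comment> \<open>The event in \<open>?I n\<close> leaves \<open>J n\<close> free, so it contains
    the event that the first visit is at \<open>n\<close>.\<close>
  let ?F = "\<lambda>n \<omega>. ennreal (real n ^ d) * (\<Sum>r=1..n. ennreal (X r \<omega> ^ d) * ?I n \<omega>)"
  have I [measurable]: "?I n \<in> borel_measurable M" for n
    using history_borel[OF history_indicator[of "{1..n - 1}" n UNIV "{k}"]] by auto
  have "(\<integral>\<^sup>+\<omega>. ennreal (reduced_X ?S J X 1 \<omega> ^ d) \<partial>M) \<le> (\<integral>\<^sup>+\<omega>. (\<Sum>n. ?F n \<omega>) \<partial>M)"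
  proof (rule nn_integral_mono_AE)
    show "AE \<omega> in M. ennreal (reduced_X ?S J X 1 \<omega> ^ d) \<le> (\<Sum>n. ?F n \<omega>)"
      using AE_visits[OF k less] AE_space
    proof eventually_elim
      case (elim \<omega>)
      let ?n = "visit_epoch ?S J 1 \<omega>"
      have n: "1 \<le> ?n"
        using visit_epoch_Suc(1)[of J \<omega> ?S 0] elim by (simp del: visit_epoch.simps(2))
      have "J s \<omega> = k" if "s \<in> {1..?n - 1}" for s
      proof (rule ccontr)
        assume "J s \<omega> \<noteq> k"
        then have "?n \<le> s"
          using visit_epoch_Suc_le[of J \<omega> ?S 0 s] elim J_le[of \<omega> s] that
          by (simp del: visit_epoch.simps(2))
        with that show False
          by auto
      qed
      then have "\<omega> \<in> {\<omega>. \<forall>s\<in>{1..?n - 1}. J s \<omega> = k}"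
        by blast
      then have I1: "?I ?n \<omega> = 1"
        by (rule indicator_simps(1))
      have "reduced_X ?S J X 1 \<omega> ^ d \<le> real ?n ^ d * (\<Sum>r=1..?n. X r \<omega> ^ d)"
        unfolding reduced_X_1
        using sum_power_le[of "{1..?n}" "\<lambda>r. X r \<omega>" d] n X_nonneg[OF elim(2)] by simp
      then have "ennreal (reduced_X ?S J X 1 \<omega> ^ d) \<le> ennreal (real ?n ^ d * (\<Sum>r=1..?n. X r \<omega> ^ d))"
        by (rule ennreal_leI)
      also have "\<dots> = ?F ?n \<omega>"
        unfolding I1 using X_nonneg[OF elim(2)] by (simp add: ennreal_mult sum_nonneg)
      \<comment> \<open>Only the term at the actual first visit epoch is needed; the others are
        nonnegative.\<close>
      also have "\<dots> = sum (\<lambda>n. ?F n \<omega>) {?n}"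
        by simp
      also have "\<dots> \<le> (\<Sum>n. ?F n \<omega>)"
        by (rule sum_le_suminf) auto
      finally show ?case .
    qed
  qed
  also have "\<dots> = (\<Sum>n. \<integral>\<^sup>+\<omega>. ?F n \<omega> \<partial>M)"
    by (rule nn_integral_suminf) measurable
  also have "\<dots> \<le> (\<Sum>n. ennreal (C * (real n ^ Suc d * c ^ (n - 3))))"
  proof (rule suminf_le)
    fix n
    have "(\<integral>\<^sup>+\<omega>. ?F n \<omega> \<partial>M) = ennreal (real n ^ d) * (\<Sum>r=1..n. \<integral>\<^sup>+\<omega>. ennreal (X r \<omega> ^ d) * ?I n \<omega> \<partial>M)"
      by (subst nn_integral_cmult, measurable, subst nn_integral_sum, measurable)
    also have "\<dots> \<le> ennreal (real n ^ d) * (\<Sum>r=1..n. ennreal C * ennreal c ^ (n - 3))"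
    proof (intro mult_left_mono sum_mono)
      fix r assume "r \<in> {1..n}"
      then show "(\<integral>\<^sup>+\<omega>. ennreal (X r \<omega> ^ d) * ?I n \<omega> \<partial>M) \<le> ennreal C * ennreal c ^ (n - 3)"
        using c C by (intro nn_integral_excursion_le) (auto simp: c_def)
    qed simp
    \<comment> \<open>The \<open>n\<close> equal summands raise the power of \<open>n\<close> from
      \<open>d\<close> to \<open>Suc d\<close>.\<close>
    also have "\<dots> = ennreal (C * (real n ^ Suc d * c ^ (n - 3)))"
      using c C(2) by (simp add: ennreal_power ennreal_mult[symmetric] ennreal_of_nat_eq_real_of_nat ac_simps)
    finally show "(\<integral>\<^sup>+\<omega>. ?F n \<omega> \<partial>M) \<le> ennreal (C * (real n ^ Suc d * c ^ (n - 3)))" .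
  qed auto
  also have "\<dots> < \<infinity>"
  proof -
    have "(\<Sum>n. ennreal (C * (real n ^ Suc d * c ^ (n - 3)))) \<noteq> top"
      by (intro ennreal_suminf_neq_top summable_mult summable_power_times_geometric c mult_nonneg_nonneg
          zero_le_power C(2) of_nat_0_le_iff)
    then show ?thesis
      by (simp add: less_top del: power_Suc)
  qed
  finally show ?thesis .
qed

lemma jump_moment_reduced_finite:
  assumes A: "communicative {0..m} (embedded Q)"
    and C: "\<forall>i\<in>{0..m}. \<forall>j\<in>{0..m}. jump_moment (P i) J X d j < \<infinity>"
    and k: "k \<in> {0..m}" "k \<noteq> 0" and i: "i \<in> {0..m}"
  shows "jump_moment (P i) (reduced_J ({0..m} - {k}) J) (reduced_X ({0..m} - {k}) J X) d j < \<infinity>"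
proof -
  interpret Pi: markov_renewal_family "P i" m "\<lambda>j. if j = i then 1 else 0" Q J X P
    by (rule family_from[OF i])
  let ?S = "{0..m} - {k}"
  \<comment> \<open>A finite sum over all pairs of states, hence a finite moment bound common to all
    starting states.\<close>
  define C where "C = (\<Sum>i\<in>{0..m}. \<Sum>j\<in>{0..m}. jump_moment (P i) J X d j)"
  have "C < \<infinity>"
    unfolding C_def using assms(2) by simp
  have le: "(\<integral>\<^sup>+\<omega>. ennreal (X 1 \<omega> ^ d) \<partial>P i) \<le> C" if i: "i \<in> {0..m}" for i
  proof -
    have "(\<integral>\<^sup>+\<omega>. ennreal (X 1 \<omega> ^ d) \<partial>P i) = kernel (\<lambda>_ x. ennreal (x ^ d)) i"
      by (simp add: kernel_def)
    also have "\<dots> = (\<Sum>j\<in>{0..m}. \<integral>\<^sup>+\<omega>. indicator {j} (J 1 \<omega>) * ennreal (X 1 \<omega> ^ d) \<partial>P i)"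
      by (rule kernel_sum[OF i]) measurable
    also have "\<dots> = (\<Sum>j\<in>{0..m}. jump_moment (P i) J X d j)"
      unfolding jump_moment_def
      by (intro sum.cong refl nn_integral_cong) (auto simp: indicator_def)
    also have "\<dots> \<le> C"
      unfolding C_def by (rule member_le_sum[OF i]) auto
    finally show ?thesis .
  qed
  have "jump_moment (P i) (reduced_J ?S J) (reduced_X ?S J X) d j \<le>
      (\<integral>\<^sup>+\<omega>. ennreal (reduced_X ?S J X 1 \<omega> ^ d) \<partial>P i)"
    unfolding jump_moment_def by (rule nn_integral_mono) (auto simp: indicator_def)
  also have "\<dots> < \<infinity>"
    using le \<open>C < \<infinity>\<close>
    by (intro Pi.nn_integral_reduced_X_power_finite[OF k(1) measure_stay_less_1[OF A k], of d "enn2real C"])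
      (auto simp: less_top)
  finally show ?thesis .
qed

end

theorem theorem1:
  fixes m d k :: nat
    and p :: "nat \<Rightarrow> real"
    and Q :: "nat \<Rightarrow> nat \<Rightarrow> real \<Rightarrow> real"
    and M :: "'w measure" and P :: "nat \<Rightarrow> 'w measure"
    and J :: "nat \<Rightarrow> 'w \<Rightarrow> nat" and X :: "nat \<Rightarrow> 'w \<Rightarrow> real"
  defines "S \<equiv> {0..m} - {k}"
  assumes process: "markov_renewal_process M m p Q J X"
    and process_from: "\<And>i. i \<in> {0..m} \<Longrightarrow>
      markov_renewal_process (P i) m (\<lambda>j. if j = i then 1 else 0) Q J X"
    and d: "d \<ge> 1"
    and A: "communicative {0..m} (embedded Q)"
    and B: "\<forall>i\<in>{0..m}. \<forall>j\<in>{0..m}. Q i j 0 = 0"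
    and C: "\<forall>i\<in>{0..m}. \<forall>j\<in>{0..m}. jump_moment (P i) J X d j < \<infinity>"
    and k: "k \<in> {0..m}" "k \<noteq> 0"
  shows "communicative S (embedded (reduced_Q S P J X)) \<and>
    (\<forall>i\<in>S. \<forall>j\<in>S. reduced_Q S P J X i j 0 = 0) \<and>
    (\<forall>i\<in>S. \<forall>j\<in>S. jump_moment (P i) (reduced_J S J) (reduced_X S J X) d j < \<infinity>) \<and>
    (AE \<omega> in M. hitting_time J X \<omega> = hitting_time (reduced_J S J) (reduced_X S J X) \<omega>) \<and>
    (\<forall>i\<in>{0..m}.
      AE \<omega> in P i. hitting_time J X \<omega> = hitting_time (reduced_J S J) (reduced_X S J X) \<omega>) \<and>
    (\<forall>r\<in>{1..d}. \<forall>i\<in>{0..m}.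
      hitting_moment (P i) J X r = hitting_moment (P i) (reduced_J S J) (reduced_X S J X) r)"
proof -
  interpret markov_renewal_family M m p Q J X P
    using process process_from by (simp add: markov_renewal_family_def markov_renewal_family_axioms_def)
  \<comment> \<open>Each \<open>P i\<close> is itself the base measure of a
    \<open>markov_renewal_family\<close>, so the almost sure equality proved for an arbitrary
    initial law applies, also to \<open>i = k\<close>.\<close>
  have AE_from: "AE \<omega> in P i. hitting_time J X \<omega> = hitting_time (reduced_J S J) (reduced_X S J X) \<omega>"
    if "i \<in> {0..m}" for i
    unfolding S_def by (rule markov_renewal_family.AE_hitting_time_reduced[OF family_from[OF that] A B k])
  have "hitting_moment (P i) J X r = hitting_moment (P i) (reduced_J S J) (reduced_X S J X) r"
    if "i \<in> {0..m}" for i r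
    unfolding hitting_moment_def
    by (rule nn_integral_cong_AE) (use AE_from[OF that] in eventually_elim, simp)
  then show ?thesis
    using communicative_reduced[OF A k(1)] reduced_Q_0[OF A B k] AE_from
      AE_hitting_time_reduced[OF A B k] jump_moment_reduced_finite[OF A C k]
    by (auto simp: S_def)
qed

end
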